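(* Let $\kappa$ be a regular uncountable cardinal and let $\lambda\ge\kappa$ be a cardinal. If $\lambda$ is a strong limit singular cardinal, then every stationary subset of $\mathcal{P}_\kappa\lambda$ can be partitioned into $\lambda^{<\kappa}$ disjoint stationary sets.
   Context: $\mathcal{P}_\kappa\lambda=\{s\subseteq\lambda : |s|<\kappa\}$. A set $C\subseteq\mathcal{P}_\kappa\lambda$ is club if it is cofinal in $(\mathcal{P}_\kappa\lambda,\subseteq)$ and closed under unions of $\subseteq$-increasing chains of length less than $\kappa$; a set $X\subseteq\mathcal{P}_\kappa\lambda$ is stationary if it meets every club subset of $\mathcal{P}_\kappa\lambda$. $\lambda^{<\kappa}=\sup_{\mu<\kappa}\lambda^{\mu}$, the supremum being over cardinals $\mu<\kappa$. *)

theory Defs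
  imports Main "HOL-Library.Disjoint_Sets"
begin

text \<open>
  A cardinal is a relation \<open>r\<close> with \<^term>\<open>Card_order r\<close>, i.e. a well-order on
  \<^term>\<open>Field r\<close> of minimal length; \<open>\<kappa> :: 'b rel\<close> and \<open>\<theta> :: 'a rel\<close> may live on
  different types, and the set underlying the cardinal \<open>\<theta>\<close> is \<^term>\<open>Field \<theta>\<close>.
  Every well-order strictly shorter than \<open>\<kappa>\<close> is isomorphic to an initial segment of \<open>\<kappa>\<close>, so
  quantifying over relations of the type of \<open>\<kappa>\<close> reaches all ordinals (and cardinals) below \<open>\<kappa>\<close>;
  likewise for \<open>\<theta>\<close>. The letter \<open>\<theta>\<close> stands for the cardinal usually called lambda.
\<close>

unbundle cardinal_syntax

definition regular_uncountable :: "'b rel \<Rightarrow> bool" where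
  "regular_uncountable \<kappa> \<longleftrightarrow> Card_order \<kappa> \<and> natLeq <o \<kappa> \<and> regularCard \<kappa>"

definition singular_cardinal :: "'a rel \<Rightarrow> bool" where
  "singular_cardinal \<theta> \<longleftrightarrow> Card_order \<theta> \<and> cinfinite \<theta> \<and> \<not> regularCard \<theta>"

definition strong_limit_cardinal :: "'a rel \<Rightarrow> bool" where
  "strong_limit_cardinal \<theta> \<longleftrightarrow> Card_order \<theta> \<and> cinfinite \<theta> \<and>
     (\<forall>\<mu>::'a rel. Card_order \<mu> \<and> \<mu> <o \<theta> \<longrightarrow> ctwo ^c \<mu> <o \<theta>)"

definition PK :: "'b rel \<Rightarrow> 'a rel \<Rightarrow> 'a set set" where
  "PK \<kappa> \<theta> = {s. s \<subseteq> Field \<theta> \<and> |s| <o \<kappa>}"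

text \<open>
  Closure under unions of increasing chains \<open>\<langle>s \<xi> : \<xi> < \<alpha>\<rangle>\<close> for ordinals \<open>0 < \<alpha> < \<kappa>\<close>; \<open>\<alpha>\<close> is
  given as a well-order. The empty chain is excluded, since it would put \<open>{}\<close> into every club set.
\<close>

definition chain_closed :: "'b rel \<Rightarrow> 'a set set \<Rightarrow> bool" where
  "chain_closed \<kappa> C \<longleftrightarrow>
     (\<forall>(\<alpha>::'b rel) (s::'b \<Rightarrow> 'a set).
        Well_order \<alpha> \<and> \<alpha> <o \<kappa> \<and> Field \<alpha> \<noteq> {} \<and>
        (\<forall>\<xi>\<in>Field \<alpha>. s \<xi> \<in> C) \<and> (\<forall>(\<xi>, \<eta>)\<in>\<alpha>. s \<xi> \<subseteq> s \<eta>)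
        \<longrightarrow> (\<Union>\<xi>\<in>Field \<alpha>. s \<xi>) \<in> C)"

definition club :: "'b rel \<Rightarrow> 'a rel \<Rightarrow> 'a set set \<Rightarrow> bool" where
  "club \<kappa> \<theta> C \<longleftrightarrow>
     C \<subseteq> PK \<kappa> \<theta> \<and> (\<forall>s\<in>PK \<kappa> \<theta>. \<exists>c\<in>C. s \<subseteq> c) \<and> chain_closed \<kappa> C"

definition stationary :: "'b rel \<Rightarrow> 'a rel \<Rightarrow> 'a set set \<Rightarrow> bool" where
  "stationary \<kappa> \<theta> X \<longleftrightarrow> X \<subseteq> PK \<kappa> \<theta> \<and> (\<forall>C. club \<kappa> \<theta> C \<longrightarrow> X \<inter> C \<noteq> {})"

definition is_card_sup :: "'c rel set \<Rightarrow> 'c rel \<Rightarrow> bool" where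
  "is_card_sup R \<nu> \<longleftrightarrow> Card_order \<nu> \<and> (\<forall>\<rho>\<in>R. \<rho> \<le>o \<nu>) \<and>
     (\<forall>\<nu>'::'c rel. Card_order \<nu>' \<and> (\<forall>\<rho>\<in>R. \<rho> \<le>o \<nu>') \<longrightarrow> \<nu> \<le>o \<nu>')"

text \<open>
  A supremum exists on the type of its members, is unique up to \<open>=o\<close>, and is a lower bound for
  the upper bounds on any other type as well; see the lemmas below.
\<close>

definition card_sup :: "'c rel set \<Rightarrow> 'c rel" where
  "card_sup R = (SOME \<nu>. is_card_sup R \<nu>)"

lemma is_card_sup_card_sup:
  fixes R :: "'c rel set"
  assumes "\<And>\<rho>. \<rho> \<in> R \<Longrightarrow> Card_order \<rho>"
  shows "is_card_sup R (card_sup R)"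
proof -
  let ?U = "{\<nu>::'c rel. Card_order \<nu> \<and> (\<forall>\<rho>\<in>R. \<rho> \<le>o \<nu>)}"
  have "\<rho> \<le>o |UNIV :: 'c set|" if "\<rho> \<in> R" for \<rho>
    using card_of_Field_ordIso[OF assms[OF that]] card_of_mono1[of "Field \<rho>" UNIV]
      ordIso_symmetric ordIso_ordLeq_trans by blast
  then have "|UNIV :: 'c set| \<in> ?U"
    by (simp add: card_of_Card_order)
  then have "?U \<noteq> {}" "\<forall>\<nu>\<in>?U. Card_order \<nu>"
    by blast+
  then obtain \<nu> where "\<nu> \<in> ?U" "\<forall>\<nu>'\<in>?U. \<nu> \<le>o \<nu>'"
    using exists_minim_Card_order[of ?U] by blast
  then have "is_card_sup R \<nu>"
    by (simp add: is_card_sup_def)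
  then show ?thesis
    unfolding card_sup_def by (rule someI)
qed

lemma is_card_sup_unique:
  assumes "is_card_sup R \<nu>" and "is_card_sup R \<nu>'"
  shows "\<nu> =o \<nu>'"
  using assms by (auto simp: is_card_sup_def ordIso_iff_ordLeq)

lemma is_card_sup_least:
  fixes \<nu> :: "'c rel" and \<nu>' :: "'d rel"
  assumes sup: "is_card_sup R \<nu>" and co: "Card_order \<nu>'" and ub: "\<And>\<rho>. \<rho> \<in> R \<Longrightarrow> \<rho> \<le>o \<nu>'"
  shows "\<nu> \<le>o \<nu>'"
proof (rule ccontr)
  have co\<nu>: "Card_order \<nu>"
    using sup by (simp add: is_card_sup_def)
  assume "\<not> \<nu> \<le>o \<nu>'"
  then have less: "\<nu>' <o \<nu>"
    using co co\<nu> by (simp add: card_order_on_well_order_on not_ordLeq_iff_ordLess)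
  have iso: "|Field \<nu>'| =o \<nu>'"
    using co by (rule card_of_Field_ordIso)
  have "|Field \<nu>'| <o \<nu>"
    using iso less by (rule ordIso_ordLess_trans)
  then obtain A :: "'c set" where A: "|Field \<nu>'| =o |A|" "|A| <o \<nu>"
    using internalize_card_of_ordLess[of "Field \<nu>'" \<nu>] by blast
  have "\<nu>' \<le>o |A|"
    using iso A(1) by (meson ordIso_symmetric ordIso_transitive ordIso_imp_ordLeq)
  then have "\<forall>\<rho>\<in>R. \<rho> \<le>o |A|"
    using ub ordLeq_transitive by blast
  then have "\<nu> \<le>o |A|"
    using sup card_of_Card_order unfolding is_card_sup_def by blast
  then show False
    using A(2) not_ordLess_ordLeq by blast
qed

definition weak_power :: "'a rel \<Rightarrow> 'b rel \<Rightarrow> ('b \<Rightarrow> 'a) rel" where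
  "weak_power \<theta> \<kappa> = card_sup {\<theta> ^c \<mu> | \<mu>::'b rel. Card_order \<mu> \<and> \<mu> <o \<kappa>}"

lemma is_card_sup_weak_power:
  fixes \<theta> :: "'a rel" and \<kappa> :: "'b rel"
  shows "is_card_sup {\<theta> ^c \<mu> | \<mu>::'b rel. Card_order \<mu> \<and> \<mu> <o \<kappa>} (weak_power \<theta> \<kappa>)"
  unfolding weak_power_def by (rule is_card_sup_card_sup) (auto intro: Card_order_cexp)

end

theory Submission
  imports Defs
begin

text \<open>
  Write \<open>\<Lambda>\<close> for the cardinality of \<open>PK \<kappa> \<theta>\<close>. Since \<open>\<theta>\<close> is a strong limit, \<open>2\<^sup>\<kappa> < \<theta>\<close>, and this
  has two consequences. First, \<open>\<Lambda>\<close> is the weak power \<open>\<theta>\<close> to the \<open><\<kappa>\<close>. Secondly, every cofinal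
  family, hence every stationary set, has full size \<open>\<Lambda>\<close>: the power sets of its members cover
  \<open>PK \<kappa> \<theta>\<close>, and each of them has at most \<open>2\<^sup>\<kappa>\<close> elements.

  One would like to split a stationary \<open>S\<close> by a transfinite choice of distinct points in the sets
  \<open>S \<inter> C\<close>, but there may be far more than \<open>\<Lambda>\<close> clubs \<open>C\<close>. The remedy is that a small set already
  knows the clubs it belongs to. Up to a fixed club, a base of the club filter consists of the sets
  closed under a finitary operation \<open>F\<close> on \<open>\<theta>\<close> (\<open>club_contains_finitary\<close>). By singularity there is
  a cofinal \<open>D \<subseteq> \<theta>\<close> with \<open>|D| < \<theta>\<close>; by the strong limit property all restrictions of operations to
  initial segments given by \<open>d \<in> D\<close> can be coded by elements of \<open>\<theta>\<close> (\<open>traces_codable\<close>). Almost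
  every \<open>s\<close> contains the codes of \<open>F\<close> at all \<open>d \<in> s \<inter> D\<close>. Let \<open>g\<close> be the resulting map from
  \<open>s \<inter> D\<close> to \<open>s\<close>, and let \<open>B g\<close> collect the \<open>s \<in> S\<close> that guess \<open>g\<close> in this way. Then

    \<^item> every member of \<open>B g\<close> is closed under every \<open>F\<close> whose codes on the domain of \<open>g\<close> are \<open>g\<close>;

    \<^item> every \<open>s\<close> lies in at most \<open>2\<^sup>\<kappa>\<close> of the sets \<open>B g\<close>, since \<open>g \<subseteq> s \<times> s\<close>;

    \<^item> for fixed \<open>F\<close>, almost all of \<open>S\<close> is covered by the sets \<open>B g\<close> with \<open>g\<close> a restriction of the code
      map of \<open>F\<close> to a subset of \<open>D\<close>. There are only \<open>2\<^bsup>|D|\<^esup> < \<theta>\<close> of them, so they cannot all be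
      small: their union has size \<open>\<Lambda>\<close>.

  A family of large sets in which each point lies in few members admits a colouring such that every
  member receives every colour (\<open>rainbow_colouring\<close>). Applied to the large \<open>B g\<close>, it makes every
  colour class stationary (\<open>splits_if_small_unions\<close>). This yields \<open>\<Lambda>\<close> colours at once when \<open>\<Lambda>\<close> is
  regular, and any number of colours below \<open>\<Lambda>\<close> in general; when \<open>\<Lambda>\<close> is singular, one splits into
  \<open>cf \<Lambda>\<close> pieces and then splits these further into sizes cofinal in \<open>\<Lambda>\<close>.
\<close>

section \<open>Cardinal arithmetic and colourings\<close>

lemma Cinfinite_card_of: "Cinfinite |A| \<longleftrightarrow> infinite A"
  by (simp add: cinfinite_def Field_card_of card_of_card_order_on)

lemma finite_card_le:
  assumes "finite A" and "Cinfinite r"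
  shows "|A| \<le>o r"
  using assms by (intro ordLess_imp_ordLeq Cfinite_ordLess_Cinfinite)
    (auto simp: cfinite_def Field_card_of card_of_card_order_on)

lemma card_lists_le:
  fixes r :: "'c rel"
  assumes r: "Cinfinite r" and X: "|X| \<le>o r"
  shows "|lists X| \<le>o r"
proof -
  have len: "|{l \<in> lists X. length l = n}| \<le>o r" for n
  proof (induction n)
    case 0
    have "{l \<in> lists X. length l = 0} \<subseteq> {[]}" by auto
    then have "finite {l \<in> lists X. length l = 0}" using finite_subset by blast
    then show ?case
      using r by (rule finite_card_le)
  next
    case (Suc n)
    let ?P = "X \<times> {l \<in> lists X. length l = n}"
    have "{l \<in> lists X. length l = Suc n} \<subseteq> (\<lambda>(x, l). x # l) ` ?P"
      by (auto simp: length_Suc_conv image_iff)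
    then have "|{l \<in> lists X. length l = Suc n}| \<le>o |?P|"
      by (rule surj_imp_ordLeq)
    moreover have "|?P| \<le>o r"
      using r X Suc by (intro card_of_Times_ordLeq_infinite_Field) (auto simp: cinfinite_def)
    ultimately show ?case by (rule ordLeq_transitive)
  qed
  have "lists X = (\<Union>n. {l \<in> lists X. length l = n})" by auto
  moreover have "|\<Union>n. {l \<in> lists X. length l = n}| \<le>o r"
    using r len natLeq_ordLeq_cinfinite[OF r] card_of_nat
    by (intro UNION_Cinfinite_bound) (auto intro: ordIso_ordLeq_trans)
  ultimately show ?thesis by simp
qed

lemma card_lists_less:
  fixes r :: "'c rel"
  assumes r: "Card_order r" and unc: "natLeq <o r" and X: "|X| <o r"
  shows "|lists X| <o r"
proof -
  have inf: "\<not> finite (Field r)"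
    using cinfinite_mono[OF ordLess_imp_ordLeq[OF unc] natLeq_cinfinite] by (simp add: cinfinite_def)
  let ?Z = "X <+> (UNIV :: nat set)"
  have "|UNIV :: nat set| <o r" using card_of_nat unc by (rule ordIso_ordLess_trans)
  then have "|?Z| <o r" by (rule card_of_Plus_ordLess_infinite_Field[OF inf r X])
  moreover have "|lists X| \<le>o |?Z|"
    by (rule card_lists_le)
      (auto simp: Cinfinite_card_of card_of_Plus1)
  ultimately show ?thesis by (rule ordLeq_ordLess_trans[rotated])
qed

text \<open>
  Points reachable in a graph are reached in finitely many steps, so bounding the out-degree by an
  infinite cardinal bounds the number of reachable points.
\<close>

lemma card_reachable_le:
  fixes r :: "'c rel"
  assumes r: "Cinfinite r" and R: "\<And>i. |R `` {i}| \<le>o r"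
  shows "|R\<^sup>* `` {i}| \<le>o r"
proof -
  have "|(R ^^ n) `` {i}| \<le>o r" for n
  proof (induction n)
    case 0
    then show ?case
      using r by (simp add: finite_card_le)
  next
    case (Suc n)
    have "(R ^^ Suc n) `` {i} = (\<Union>j\<in>(R ^^ n) `` {i}. R `` {j})" by auto
    moreover have "|\<Union>j\<in>(R ^^ n) `` {i}. R `` {j}| \<le>o r"
      using Suc R r by (intro UNION_Cinfinite_bound) auto
    ultimately show ?case by simp
  qed
  then have "|\<Union>n. (R ^^ n) `` {i}| \<le>o r"
    using r ordIso_ordLeq_trans[OF card_of_nat natLeq_ordLeq_cinfinite[OF r]]
    by (intro UNION_Cinfinite_bound) auto
  moreover have "R\<^sup>* `` {i} = (\<Union>n. (R ^^ n) `` {i})" by (auto simp: rtrancl_power)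
  ultimately show ?thesis by simp
qed

text \<open>
  Choose along a well-order of \<open>I\<close> of minimal length: at each stage fewer than \<open>|I|\<close> points are
  already used up, too few to exhaust \<open>B i\<close>.
\<close>

lemma injective_choice:
  fixes B :: "'i \<Rightarrow> 'p set"
  assumes "\<And>i. i \<in> I \<Longrightarrow> |I| \<le>o |B i|"
  shows "\<exists>q. inj_on q I \<and> (\<forall>i\<in>I. q i \<in> B i)"
proof -
  let ?r = "|I|"
  have wo: "Well_order ?r" by (rule card_of_Well_order)
  then have wf: "wf (?r - Id)" by (simp add: well_order_on_def)
  define q where "q = wfrec (?r - Id) (\<lambda>f i. SOME p. p \<in> B i \<and> p \<notin> f ` underS ?r i)"
  have q_eq: "q i = (SOME p. p \<in> B i \<and> p \<notin> q ` underS ?r i)" for i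
  proof -
    have "cut q (?r - Id) i ` underS ?r i = q ` underS ?r i"
      by (auto simp: underS_def cut_apply image_iff)
    then show ?thesis
      using def_wfrec[of q "?r - Id" "\<lambda>f i. SOME p. p \<in> B i \<and> p \<notin> f ` underS ?r i", OF _ wf] q_def
      by simp
  qed
  have q: "q i \<in> B i \<and> q i \<notin> q ` underS ?r i" if i: "i \<in> I" for i
  proof -
    have "|q ` underS ?r i| \<le>o |underS ?r i|" by (rule card_of_image)
    also have "|underS ?r i| <o ?r" using i card_of_underS[OF card_of_Card_order] by (simp add: Field_card_of)
    also have "?r \<le>o |B i|" using assms i .
    finally have "|q ` underS ?r i| <o |B i|" .
    then have "\<not> B i \<subseteq> q ` underS ?r i"
      using card_of_mono1 not_ordLess_ordLeq by blast
    then have "\<exists>p. p \<in> B i \<and> p \<notin> q ` underS ?r i" by blast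
    then show ?thesis unfolding q_eq[of i] by (rule someI_ex)
  qed
  have "inj_on q I"
  proof (rule inj_onI, rule ccontr)
    fix i j assume ij: "i \<in> I" "j \<in> I" "q i = q j" "i \<noteq> j"
    then have "(i, j) \<in> ?r \<or> (j, i) \<in> ?r"
      using wo by (auto simp: well_order_on_def linear_order_on_def total_on_def Field_card_of)
    then have "i \<in> underS ?r j \<or> j \<in> underS ?r i" using ij(4) by (auto simp: underS_def)
    then show False using q[OF ij(1)] q[OF ij(2)] ij(3) by (metis imageI)
  qed
  then show ?thesis using q by blast
qed

text \<open>
  The index set may be much larger than \<open>J\<close>, so \<open>injective_choice\<close> does not apply to all of
  \<open>I \<times> J\<close>. But once every \<open>B i\<close> is shrunk to size exactly \<open>|J|\<close>, it meets at most \<open>|J|\<close> others, and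
  the index set falls into connected components of size at most \<open>|J|\<close>. Sets from different
  components are disjoint, so the choices made within the components do not interfere.
\<close>

lemma rainbow_colouring:
  fixes B :: "'i \<Rightarrow> 'p set" and J :: "'j set"
  assumes J: "infinite J"
    and big: "\<And>i. i \<in> I \<Longrightarrow> |J| \<le>o |B i|"
    and deg: "\<And>p. |{i \<in> I. p \<in> B i}| \<le>o |J|"
  shows "\<exists>\<chi>. \<forall>i\<in>I. \<forall>j\<in>J. \<exists>p\<in>B i. \<chi> p = j"
proof -
  have CJ: "Cinfinite |J|" using J by (simp add: Cinfinite_card_of)
  have "\<exists>C. C \<subseteq> B i \<and> |J| =o |C|" if "i \<in> I" for i
    using big[OF that] internalize_card_of_ordLeq2[of J "B i"] by blast
  then obtain C where C: "\<And>i. i \<in> I \<Longrightarrow> C i \<subseteq> B i" "\<And>i. i \<in> I \<Longrightarrow> |J| =o |C i|" by metis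
  \<comment> \<open>Edges join indices whose shrunken sets intersect; cls i is the component of i.\<close>
  define R where "R = {(i, i'). i \<in> I \<and> i' \<in> I \<and> C i \<inter> C i' \<noteq> {}}"
  have R: "|R `` {i}| \<le>o |J|" for i
  proof (cases "i \<in> I")
    case True
    have "R `` {i} \<subseteq> (\<Union>p\<in>C i. {i' \<in> I. p \<in> B i'})" using C(1) by (auto simp: R_def)
    moreover have "|\<Union>p\<in>C i. {i' \<in> I. p \<in> B i'}| \<le>o |J|"
      using CJ deg ordIso_imp_ordLeq[OF ordIso_symmetric[OF C(2)[OF True]]]
      by (intro UNION_Cinfinite_bound) auto
    ultimately show ?thesis using card_of_mono1 ordLeq_transitive by blast
  next
    case False
    then have "R `` {i} = {}" by (auto simp: R_def)
    then show ?thesis by (simp add: card_of_empty)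
  qed
  define cls where "cls i = R\<^sup>* `` {i}" for i
  have symR: "sym R" by (auto simp: R_def sym_def)
  have cls_eq: "cls i = cls i'" if "(i, i') \<in> R" for i i'
  proof -
    have "(i, i') \<in> R\<^sup>*" "(i', i) \<in> R\<^sup>*" using that symR by (auto dest: symD)
    then show ?thesis unfolding cls_def by (auto intro: rtrancl_trans)
  qed
  have cls_sub: "cls i \<subseteq> I" if "i \<in> I" for i
  proof
    fix x assume "x \<in> cls i"
    then have "(i, x) \<in> R\<^sup>*" by (simp add: cls_def)
    then show "x \<in> I" using that by (induction) (auto simp: R_def)
  qed
  have "\<exists>q. inj_on q (cls i \<times> J) \<and> (\<forall>x\<in>cls i \<times> J. q x \<in> C (fst x))" if i: "i \<in> I" for i
  proof (rule injective_choice)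
    fix x assume x: "x \<in> cls i \<times> J"
    have "|cls i| \<le>o |J|" unfolding cls_def by (rule card_reachable_le[OF CJ R])
    then have "|cls i \<times> J| \<le>o |J|"
      using CJ by (intro card_of_Times_ordLeq_infinite_Field) (auto simp: cinfinite_def intro: ordLeq_refl)
    moreover have "|J| =o |C (fst x)|" using C(2) cls_sub[OF i] x by auto
    ultimately show "|cls i \<times> J| \<le>o |C (fst x)|" by (rule ordLeq_ordIso_trans)
  qed
  then have "\<forall>K\<in>cls ` I. \<exists>q. inj_on q (K \<times> J) \<and> (\<forall>x\<in>K \<times> J. q x \<in> C (fst x))"
    by blast
  from bchoice[OF this] obtain q
    where "\<forall>K\<in>cls ` I. inj_on (q K) (K \<times> J) \<and> (\<forall>x\<in>K \<times> J. q K x \<in> C (fst x))" ..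
  then have q_inj: "\<And>i. i \<in> I \<Longrightarrow> inj_on (q (cls i)) (cls i \<times> J)"
    and q_in: "\<And>i x. i \<in> I \<Longrightarrow> x \<in> cls i \<times> J \<Longrightarrow> q (cls i) x \<in> C (fst x)" by (metis imageI)+
  have self: "i \<in> cls i" for i by (simp add: cls_def)
  \<comment> \<open>The choice function depends on the component only, so g is injective on all of \<open>I \<times> J\<close>.\<close>
  define g where "g = (\<lambda>(i, j). q (cls i) (i, j))"
  have g_in: "g (i, j) \<in> C i" if "i \<in> I" "j \<in> J" for i j
    using q_in[of i "(i, j)"] that self by (simp add: g_def)
  have "inj_on g (I \<times> J)"
  proof (rule inj_onI, clarify)
    fix i j i' j' assume h: "i \<in> I" "j \<in> J" "i' \<in> I" "j' \<in> J" "g (i, j) = g (i', j')"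
    then have "C i \<inter> C i' \<noteq> {}" using g_in[of i j] g_in[of i' j'] by auto
    then have "cls i = cls i'" using h by (intro cls_eq) (auto simp: R_def)
    then show "i = i' \<and> j = j'"
      using q_inj[of i] h self[of i] self[of i'] by (auto simp: g_def dest!: inj_onD)
  qed
  then have "snd (the_inv_into (I \<times> J) g (g (i, j))) = j" if "i \<in> I" "j \<in> J" for i j
    using that by (simp add: the_inv_into_f_f)
  then show ?thesis
    using g_in C(1) by (intro exI[of _ "\<lambda>p. snd (the_inv_into (I \<times> J) g p)"]) blast
qed

section \<open>Clubs and closure under operations\<close>

lemma regular_uncountableD:
  assumes "regular_uncountable \<kappa>"
  shows "Card_order \<kappa>" "natLeq <o \<kappa>" "regularCard \<kappa>" "Cinfinite \<kappa>"
  using assms cinfinite_mono[OF ordLess_imp_ordLeq natLeq_cinfinite]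
  by (auto simp: regular_uncountable_def)

lemma PK_subset: "s \<in> PK \<kappa> \<theta> \<Longrightarrow> t \<subseteq> s \<Longrightarrow> t \<in> PK \<kappa> \<theta>"
  unfolding PK_def using ordLeq_ordLess_trans[OF card_of_mono1[of t s]] by blast

lemma PK_UN:
  assumes \<kappa>: "regular_uncountable \<kappa>" and I: "|I| <o \<kappa>" and A: "\<And>i. i \<in> I \<Longrightarrow> A i \<in> PK \<kappa> \<theta>"
  shows "(\<Union>i\<in>I. A i) \<in> PK \<kappa> \<theta>"
proof -
  note \<kappa> = regular_uncountableD[OF \<kappa>]
  have "|\<Union>i\<in>I. A i| <o \<kappa>"
    using A I by (intro card_of_UNION_ordLess_infinite_Field_regularCard[OF \<kappa>(3,4)]) (auto simp: PK_def)
  then show ?thesis using A by (auto simp: PK_def)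
qed

lemma finite_less_regular:
  assumes \<kappa>: "regular_uncountable \<kappa>" and "finite s"
  shows "|s| <o \<kappa>"
  using ordLess_transitive[OF _ regular_uncountableD(2)[OF \<kappa>]] assms(2) finite_iff_ordLess_natLeq[of s]
  by blast

lemma PK_finite:
  assumes "regular_uncountable \<kappa>" and "finite s" and "s \<subseteq> Field \<theta>"
  shows "s \<in> PK \<kappa> \<theta>"
  using assms finite_less_regular by (auto simp: PK_def)

lemma PK_Un:
  assumes \<kappa>: "regular_uncountable \<kappa>" and "s \<in> PK \<kappa> \<theta>" and "t \<in> PK \<kappa> \<theta>"
  shows "s \<union> t \<in> PK \<kappa> \<theta>"
  using PK_UN[OF \<kappa> finite_less_regular[OF \<kappa>, of "{True, False}"], of "\<lambda>b. if b then s else t" \<theta>] assms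
  by (auto simp: Un_commute)

lemma list_in_directed_union:
  assumes "I \<noteq> {}" and dir: "\<And>i j. i \<in> I \<Longrightarrow> j \<in> I \<Longrightarrow> \<exists>k\<in>I. A i \<union> A j \<subseteq> A k"
    and l: "l \<in> lists (\<Union>i\<in>I. A i)"
  shows "\<exists>i\<in>I. l \<in> lists (A i)"
  using l
proof (induction l)
  case Nil
  then show ?case using assms(1) by auto
next
  case (Cons x l)
  then obtain i where i: "i \<in> I" "l \<in> lists (A i)" by auto
  moreover obtain j where j: "j \<in> I" "x \<in> A j" using Cons.hyps by auto
  ultimately obtain k where "k \<in> I" "A i \<union> A j \<subseteq> A k" using dir by blast
  then show ?case using i j by (intro bexI[of _ k]) auto
qed

definition closed_under :: "('a list \<Rightarrow> 'a set) \<Rightarrow> 'a set \<Rightarrow> bool" where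
  "closed_under G s \<longleftrightarrow> (\<forall>l\<in>lists s. G l \<subseteq> s)"

lemma closed_under_directed_union:
  assumes "I \<noteq> {}" and "\<And>i j. i \<in> I \<Longrightarrow> j \<in> I \<Longrightarrow> \<exists>k\<in>I. A i \<union> A j \<subseteq> A k"
    and "\<And>i l. i \<in> I \<Longrightarrow> l \<in> lists (A i) \<Longrightarrow> G l \<subseteq> (\<Union>i\<in>I. A i)"
  shows "closed_under G (\<Union>i\<in>I. A i)"
  unfolding closed_under_def
proof
  fix l assume "l \<in> lists (\<Union>i\<in>I. A i)"
  then obtain i where "i \<in> I" "l \<in> lists (A i)"
    using list_in_directed_union[OF assms(1,2)] by blast
  then show "G l \<subseteq> (\<Union>i\<in>I. A i)" by (rule assms(3))
qed

lemma well_order_chain_directed: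
  assumes "Well_order \<alpha>" and "\<forall>(\<xi>, \<eta>)\<in>\<alpha>. A \<xi> \<subseteq> A \<eta>" and "\<xi> \<in> Field \<alpha>" and "\<eta> \<in> Field \<alpha>"
  shows "\<exists>\<zeta>\<in>Field \<alpha>. A \<xi> \<union> A \<eta> \<subseteq> A \<zeta>"
proof -
  have "(\<xi>, \<eta>) \<in> \<alpha> \<or> (\<eta>, \<xi>) \<in> \<alpha> \<or> \<xi> = \<eta>"
    using assms by (auto simp: well_order_on_def linear_order_on_def total_on_def)
  then show ?thesis using assms by blast
qed

text \<open>
  Cofinality comes from closing off \<open>\<omega>\<close> many times, which stays below \<open>\<kappa>\<close> because \<open>\<kappa>\<close> is regular
  and uncountable; closure under chains holds since a list over a union of a chain is a list over
  one of its members.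
\<close>

lemma club_closed_under:
  fixes \<kappa> :: "'b rel" and \<theta> :: "'a rel"
  assumes \<kappa>: "regular_uncountable \<kappa>" and G: "\<And>l. l \<in> lists (Field \<theta>) \<Longrightarrow> G l \<in> PK \<kappa> \<theta>"
  shows "club \<kappa> \<theta> {s \<in> PK \<kappa> \<theta>. closed_under G s}"
proof -
  note \<kappa>' = regular_uncountableD[OF \<kappa>]
  have cofinal: "\<exists>c\<in>{s \<in> PK \<kappa> \<theta>. closed_under G s}. s \<subseteq> c" if s: "s \<in> PK \<kappa> \<theta>" for s
  proof -
    define step where "step t = t \<union> (\<Union>l\<in>lists t. G l)" for t
    define T where "T n = (step ^^ n) s" for n
    have T: "T n \<in> PK \<kappa> \<theta>" for n
    proof (induction n)
      case 0
      then show ?case using s by (simp add: T_def)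
    next
      case (Suc n)
      have "|lists (T n)| <o \<kappa>"
        using Suc by (intro card_lists_less[OF \<kappa>'(1,2)]) (simp add: PK_def)
      moreover have "G l \<in> PK \<kappa> \<theta>" if "l \<in> lists (T n)" for l
        using that Suc lists_mono[of "T n" "Field \<theta>"] by (intro G) (auto simp: PK_def)
      ultimately have "(\<Union>l\<in>lists (T n). G l) \<in> PK \<kappa> \<theta>" by (rule PK_UN[OF \<kappa>])
      then show ?case using PK_Un[OF \<kappa> Suc] by (simp add: T_def step_def)
    qed
    have mono: "T n \<subseteq> T m" if "n \<le> m" for n m
      using that by (induction rule: dec_induct) (auto simp: T_def step_def)
    have "(\<Union>n\<in>UNIV. T n) \<in> PK \<kappa> \<theta>"
      using ordIso_ordLess_trans[OF card_of_nat \<kappa>'(2)] T by (intro PK_UN[OF \<kappa>])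
    moreover have "closed_under G (\<Union>n\<in>UNIV. T n)"
    proof (rule closed_under_directed_union)
      show "\<exists>k\<in>UNIV. T i \<union> T j \<subseteq> T k" for i j
        using mono[of i "max i j"] mono[of j "max i j"] by auto
      show "G l \<subseteq> (\<Union>n\<in>UNIV. T n)" if "l \<in> lists (T i)" for i l
      proof -
        have "G l \<subseteq> T (Suc i)" using that by (auto simp: T_def step_def)
        then show ?thesis by blast
      qed
    qed auto
    moreover have "s \<subseteq> (\<Union>n\<in>UNIV. T n)" by (auto simp: T_def intro!: exI[of _ 0])
    ultimately show ?thesis by blast
  qed
  have "chain_closed \<kappa> {s \<in> PK \<kappa> \<theta>. closed_under G s}"
    unfolding chain_closed_def
  proof (intro allI impI, elim conjE)
    fix \<alpha> :: "'b rel" and A :: "'b \<Rightarrow> 'a set"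
    assume \<alpha>: "Well_order \<alpha>" "\<alpha> <o \<kappa>" "Field \<alpha> \<noteq> {}"
      and A: "\<forall>\<xi>\<in>Field \<alpha>. A \<xi> \<in> {s \<in> PK \<kappa> \<theta>. closed_under G s}" "\<forall>(\<xi>, \<eta>)\<in>\<alpha>. A \<xi> \<subseteq> A \<eta>"
    have "(\<Union>\<xi>\<in>Field \<alpha>. A \<xi>) \<in> PK \<kappa> \<theta>"
      using ordLess_Field[OF \<alpha>(2)] A(1) by (intro PK_UN[OF \<kappa>]) auto
    moreover have "closed_under G (\<Union>\<xi>\<in>Field \<alpha>. A \<xi>)"
    proof (rule closed_under_directed_union[OF \<alpha>(3)])
      show "\<exists>k\<in>Field \<alpha>. A i \<union> A j \<subseteq> A k" if "i \<in> Field \<alpha>" "j \<in> Field \<alpha>" for i j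
        using well_order_chain_directed[OF \<alpha>(1) A(2) that] .
      show "G l \<subseteq> (\<Union>\<xi>\<in>Field \<alpha>. A \<xi>)" if "i \<in> Field \<alpha>" "l \<in> lists (A i)" for i l
        using that A(1) by (auto simp: closed_under_def)
    qed
    ultimately show "(\<Union>\<xi>\<in>Field \<alpha>. A \<xi>) \<in> {s \<in> PK \<kappa> \<theta>. closed_under G s}" by simp
  qed
  then show ?thesis using cofinal by (auto simp: club_def)
qed

text \<open>
  If \<open>e\<close> picks a member of a club above every small set, then \<open>hull e\<close> is a monotone map from finite
  sets into the club. The recursion is over proper subsets; the guard on finiteness makes it
  terminate for every argument.
\<close>

function hull :: "('a set \<Rightarrow> 'a set) \<Rightarrow> 'a set \<Rightarrow> 'a set" where
  "hull e a = e (a \<union> (\<Union>b\<in>{b. finite a \<and> b \<subset> a}. hull e b))"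
  by auto
termination
  by (relation "measure (\<lambda>(e, a). card a)") (auto intro: psubset_card_mono)
declare hull.simps [simp del]

lemma hull_props:
  assumes \<kappa>: "regular_uncountable \<kappa>" and C: "C \<subseteq> PK \<kappa> \<theta>"
    and e: "\<forall>s\<in>PK \<kappa> \<theta>. e s \<in> C \<and> s \<subseteq> e s"
    and "finite a" and "a \<subseteq> Field \<theta>"
  shows "hull e a \<in> C \<and> a \<subseteq> hull e a \<and> (\<forall>b\<subseteq>a. hull e b \<subseteq> hull e a)"
  using assms(4,5)
proof (induction a rule: finite_psubset_induct)
  case (psubset a)
  let ?t = "a \<union> (\<Union>b\<in>{b. finite a \<and> b \<subset> a}. hull e b)"
  have "(\<Union>b\<in>{b. finite a \<and> b \<subset> a}. hull e b) \<in> PK \<kappa> \<theta>"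
  proof (rule PK_UN[OF \<kappa>])
    have "{b. finite a \<and> b \<subset> a} \<subseteq> Pow a" by auto
    moreover have "finite (Pow a)" using psubset.hyps(1) by (simp only: finite_Pow_iff)
    ultimately have "finite {b. finite a \<and> b \<subset> a}" by (rule finite_subset)
    then show "|{b. finite a \<and> b \<subset> a}| <o \<kappa>" by (rule finite_less_regular[OF \<kappa>])
  next
    fix b assume "b \<in> {b. finite a \<and> b \<subset> a}"
    then have ba: "b \<subset> a" by simp
    then have "b \<subseteq> Field \<theta>" using psubset.prems by (rule order_trans[OF psubset_imp_subset])
    from psubset.IH[OF ba this] have "hull e b \<in> C" by (rule conjunct1)
    then show "hull e b \<in> PK \<kappa> \<theta>" using C by blast
  qed
  then have "?t \<in> PK \<kappa> \<theta>"
    by (rule PK_Un[OF \<kappa> PK_finite[OF \<kappa> psubset.hyps(1) psubset.prems]])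
  with e have e': "e ?t \<in> C \<and> ?t \<subseteq> e ?t" by (rule bspec)
  moreover have "hull e a = e ?t" by (rule hull.simps)
  ultimately have "hull e a \<in> C" and sub: "?t \<subseteq> hull e a" by (simp_all only:)
  moreover have "hull e b \<subseteq> hull e a" if "b \<subseteq> a" for b
  proof (cases "b = a")
    case False
    then have "b \<in> {b. finite a \<and> b \<subset> a}" using that psubset.hyps(1) by simp
    then have "hull e b \<subseteq> ?t" by (intro le_supI2 UN_upper)
    then show ?thesis using sub by (rule order_trans)
  qed simp
  moreover have "a \<subseteq> hull e a" using sub by (rule order_trans[OF Un_upper1])
  ultimately show ?case by (intro conjI allI impI)
qed

text \<open>
  A theorem of Menas: with \<open>U t\<close> the union of the hulls of the finite subsets of \<open>t\<close>, induction on
  \<open>|t|\<close> shows that \<open>U t\<close> belongs to the club. An infinite \<open>t\<close> is the union of an increasing chain of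
  smaller sets, indexed by the cardinal \<open>|t| < \<kappa>\<close>, and \<open>U\<close> commutes with this union. Finally
  \<open>U s = s\<close> when \<open>s\<close> is closed under hulls.
\<close>

lemma club_contains_closed_under:
  assumes \<kappa>: "regular_uncountable \<kappa>" and club: "club \<kappa> \<theta> C"
  shows "\<exists>G. (\<forall>l\<in>lists (Field \<theta>). G l \<in> PK \<kappa> \<theta>) \<and> {s \<in> PK \<kappa> \<theta>. closed_under G s} \<subseteq> C"
proof -
  have C: "C \<subseteq> PK \<kappa> \<theta>" and chain: "chain_closed \<kappa> C" using club by (auto simp: club_def)
  have "\<forall>s\<in>PK \<kappa> \<theta>. \<exists>c. c \<in> C \<and> s \<subseteq> c" using club by (auto simp: club_def)
  from bchoice[OF this] obtain e where e: "\<forall>s\<in>PK \<kappa> \<theta>. e s \<in> C \<and> s \<subseteq> e s" ..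
  note hull = hull_props[OF \<kappa> C e]
  define U where "U t = (\<Union>a\<in>{a. finite a \<and> a \<subseteq> t}. hull e a)" for t
  have U_mono: "U t \<subseteq> U t'" if "t \<subseteq> t'" for t t'
    using that by (auto simp: U_def)
  have U: "U t \<in> C" if "t \<in> PK \<kappa> \<theta>" for t
    using that
  proof (induction "|t|" arbitrary: t rule: wf_induct_rule[OF wf_ordLess])
    case (1 t)
    have t: "t \<subseteq> Field \<theta>" "|t| <o \<kappa>" using 1(2) by (auto simp: PK_def)
    show ?case
    proof (cases "finite t")
      case True
      have "U t = hull e t" using hull[OF True t(1)] True by (auto simp: U_def)
      then show ?thesis using hull[OF True t(1)] by simp
    next
      case False
      obtain B where B: "B \<subset> Field \<kappa>" "|t| =o |B|" "|B| <o \<kappa>"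
        using t(2) internalize_card_of_ordLess[of t \<kappa>] by blast
      obtain f where f: "bij_betw f B t"
        using ordIso_symmetric[OF B(2)] card_of_ordIso[of B t] by blast
      have infB: "infinite B" using False card_of_ordIso_finite[OF B(2)] by blast
      \<comment> \<open>The index set of the chain has to live on the type of \<open>\<kappa>\<close>; B is a copy of t there.\<close>
      define A where "A \<xi> = f ` underS |B| \<xi>" for \<xi>
      have A_mono: "A \<xi> \<subseteq> A \<eta>" if "(\<xi>, \<eta>) \<in> |B|" for \<xi> \<eta>
        using that underS_incr[of "|B|"] card_of_Well_order[of B]
        by (auto simp: A_def order_on_defs intro!: image_mono)
      have A_sub: "A \<xi> \<subseteq> t" for \<xi>
        using f underS_Field[of _ "|B|" \<xi>] by (auto simp: A_def bij_betw_def Field_card_of)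
      have UA: "U (A \<xi>) \<in> C" if "\<xi> \<in> B" for \<xi>
      proof (rule 1(1))
        have "|A \<xi>| \<le>o |underS |B| \<xi>|" unfolding A_def by (rule card_of_image)
        also have "|underS |B| \<xi>| <o |B|"
          using that card_of_underS[OF card_of_Card_order] by (simp add: Field_card_of)
        finally show "( |A \<xi>|, |t| ) \<in> ordLess" 
          by (rule ordLess_ordIso_trans[OF _ ordIso_symmetric[OF B(2)]])
        show "A \<xi> \<in> PK \<kappa> \<theta>" using PK_subset[OF 1(2) A_sub] .
      qed
      have "(\<Union>\<xi>\<in>B. U (A \<xi>)) \<in> C"
      proof -
        have "(\<Union>\<xi>\<in>Field |B|. U (A \<xi>)) \<in> C"
        proof (rule chain[unfolded chain_closed_def, rule_format], intro conjI)
          show "\<forall>(\<xi>, \<eta>)\<in>|B|. U (A \<xi>) \<subseteq> U (A \<eta>)" using A_mono U_mono by blast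
          show "Field |B| \<noteq> {}" using infB by (auto simp: Field_card_of)
        qed (use UA card_of_Well_order B(3) in \<open>auto simp: Field_card_of\<close>)
        then show ?thesis by (simp add: Field_card_of)
      qed
      moreover have "U t \<subseteq> (\<Union>\<xi>\<in>B. U (A \<xi>))"
      proof
        fix x assume "x \<in> U t"
        then obtain a where a: "finite a" "a \<subseteq> t" "x \<in> hull e a" by (auto simp: U_def)
        have "t \<subseteq> (\<Union>\<xi>\<in>B. A \<xi>)"
        proof
          fix y assume "y \<in> t"
          then obtain \<xi> where \<xi>: "\<xi> \<in> B" "y = f \<xi>" using f by (auto simp: bij_betw_def)
          \<comment> \<open>An infinite cardinal has no last element, so the proper initial segments already cover it.\<close>
          then obtain \<eta> where "\<eta> \<in> B" "\<xi> \<noteq> \<eta>" "(\<xi>, \<eta>) \<in> |B|"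
            using infinite_Card_order_limit[of "|B|" \<xi>] infB card_of_Card_order
            by (auto simp: Field_card_of)
          then show "y \<in> (\<Union>\<xi>\<in>B. A \<xi>)" using \<xi> by (auto simp: A_def underS_def)
        qed
        moreover obtain l where l: "set l = a" using finite_list[OF a(1)] by blast
        ultimately have "l \<in> lists (\<Union>\<xi>\<in>B. A \<xi>)" using a(2) by (auto simp: lists_eq_set)
        then have "\<exists>\<xi>\<in>B. l \<in> lists (A \<xi>)"
        proof (rule list_in_directed_union[rotated 2])
          show "\<exists>k\<in>B. A i \<union> A j \<subseteq> A k" if "i \<in> B" "j \<in> B" for i j
            using well_order_chain_directed[OF card_of_Well_order[of B], of A i j] A_mono that
            unfolding Field_card_of by blast
        qed (use infB in auto)
        then obtain \<xi> where "\<xi> \<in> B" "a \<subseteq> A \<xi>" using l by (auto simp: lists_eq_set)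
        then show "x \<in> (\<Union>\<xi>\<in>B. U (A \<xi>))" using a by (auto simp: U_def)
      qed
      moreover have "(\<Union>\<xi>\<in>B. U (A \<xi>)) \<subseteq> U t" using U_mono[OF A_sub] by blast
      ultimately show ?thesis by (simp add: antisym)
    qed
  qed
  have "s \<in> C" if s: "s \<in> PK \<kappa> \<theta>" "closed_under (\<lambda>l. hull e (set l)) s" for s
  proof -
    have "U s \<subseteq> s"
    proof
      fix x assume "x \<in> U s"
      then obtain a where a: "finite a" "a \<subseteq> s" "x \<in> hull e a" by (auto simp: U_def)
      moreover obtain l where "set l = a" using finite_list[OF a(1)] by blast
      ultimately show "x \<in> s" using s(2) by (auto simp: closed_under_def lists_eq_set)
    qed
    moreover have "s \<subseteq> U s"
    proof
      fix x assume "x \<in> s"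
      moreover from this have "x \<in> hull e {x}" using hull[of "{x}"] s(1) by (auto simp: PK_def)
      ultimately show "x \<in> U s" by (auto simp: U_def intro!: exI[of _ "{x}"])
    qed
    ultimately show ?thesis using U[OF s(1)] by simp
  qed
  moreover have "hull e (set l) \<in> PK \<kappa> \<theta>" if "l \<in> lists (Field \<theta>)" for l
    using hull[of "set l"] that C by (auto simp: lists_eq_set)
  ultimately show ?thesis by (intro exI[of _ "\<lambda>l. hull e (set l)"]) auto
qed

lemma stationary_Int_closed_under:
  assumes \<kappa>: "regular_uncountable \<kappa>" and S: "stationary \<kappa> \<theta> S"
    and G: "\<And>l. l \<in> lists (Field \<theta>) \<Longrightarrow> G l \<in> PK \<kappa> \<theta>"
  shows "stationary \<kappa> \<theta> {s \<in> S. closed_under G s}"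
  unfolding stationary_def
proof (intro conjI allI impI)
  show "{s \<in> S. closed_under G s} \<subseteq> PK \<kappa> \<theta>" using S by (auto simp: stationary_def)
  fix C assume "club \<kappa> \<theta> C"
  then obtain H where H: "\<forall>l\<in>lists (Field \<theta>). H l \<in> PK \<kappa> \<theta>"
    and HC: "{s \<in> PK \<kappa> \<theta>. closed_under H s} \<subseteq> C"
    using club_contains_closed_under[OF \<kappa>] by blast
  have "club \<kappa> \<theta> {s \<in> PK \<kappa> \<theta>. closed_under (\<lambda>l. G l \<union> H l) s}"
    using G H by (intro club_closed_under[OF \<kappa>] PK_Un[OF \<kappa>]) auto
  then obtain s where "s \<in> S" "s \<in> PK \<kappa> \<theta>" "closed_under (\<lambda>l. G l \<union> H l) s"
    using S by (auto simp: stationary_def)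
  then have "closed_under G s" "closed_under H s" by (auto simp: closed_under_def)
  then have "s \<in> {s \<in> S. closed_under G s} \<inter> C"
    using HC \<open>s \<in> S\<close> \<open>s \<in> PK \<kappa> \<theta>\<close> by blast
  then show "{s \<in> S. closed_under G s} \<inter> C \<noteq> {}" by blast
qed

lemma stationary_mono:
  "stationary \<kappa> \<theta> X \<Longrightarrow> X \<subseteq> Y \<Longrightarrow> Y \<subseteq> PK \<kappa> \<theta> \<Longrightarrow> stationary \<kappa> \<theta> Y"
  by (fastforce simp: stationary_def)

section \<open>The cardinality of cofinal and stationary sets\<close>

lemma card_Pow_mono:
  assumes "|A| \<le>o |B|"
  shows "|Pow A| \<le>o |Pow B|"
proof -
  obtain f where "inj_on f A" "f ` A \<subseteq> B" using assms card_of_ordLeq[of A B] by blast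
  then show ?thesis
    by (intro card_of_ordLeqI[of "image f"]) (auto intro: inj_on_image_Pow)
qed

lemma card_Pow_eq_cexp: "|Pow X| =o ctwo ^c |X|"
  using card_of_Pow_Func[of X] by (simp add: cexp_def ctwo_def Field_card_of)

text \<open>
  Transfers the strong limit property from cardinals on the type of \<open>\<theta>\<close> to sets over any type.
\<close>

lemma strong_limit_Pow:
  fixes \<theta> :: "'a rel" and X :: "'x set"
  assumes \<theta>: "strong_limit_cardinal \<theta>" and X: "|X| <o \<theta>"
  shows "|Pow X| <o \<theta>"
proof -
  obtain A where A: "A \<subset> Field \<theta>" "|X| =o |A|" "|A| <o \<theta>"
    using X internalize_card_of_ordLess[of X \<theta>] by blast
  have "|Pow X| =o ctwo ^c |X|" by (rule card_Pow_eq_cexp)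
  also have "ctwo ^c |X| =o ctwo ^c |A|"
    by (rule cexp_cong2[OF A(2) Card_order_ctwo card_of_Card_order])
  also have "ctwo ^c |A| <o \<theta>"
    using \<theta> A(3) card_of_Card_order unfolding strong_limit_cardinal_def by blast
  finally show ?thesis .
qed

lemma stationary_cofinal:
  assumes \<kappa>: "regular_uncountable \<kappa>" and S: "stationary \<kappa> \<theta> S" and s: "s \<in> PK \<kappa> \<theta>"
  shows "\<exists>x\<in>S. s \<subseteq> x"
proof -
  have "stationary \<kappa> \<theta> {x \<in> S. closed_under (\<lambda>_. s) x}"
    using s by (intro stationary_Int_closed_under[OF \<kappa> S])
  moreover have "club \<kappa> \<theta> {x \<in> PK \<kappa> \<theta>. closed_under (\<lambda>_. s) x}"
    using s by (intro club_closed_under[OF \<kappa>])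
  ultimately obtain x where "x \<in> S" "closed_under (\<lambda>_. s) x"
    unfolding stationary_def by blast
  then show ?thesis by (auto simp: closed_under_def)
qed

locale strong_limit_PK =
  fixes \<kappa> :: "'b rel" and \<theta> :: "'a rel"
  assumes \<kappa>: "regular_uncountable \<kappa>"
    and \<theta>: "strong_limit_cardinal \<theta>"
    and less: "\<kappa> <o \<theta>"
begin

lemma cardinals: "Cinfinite \<kappa>" "Cinfinite \<theta>" "Card_order \<kappa>" "Card_order \<theta>"
  using regular_uncountableD(4)[OF \<kappa>] \<theta> by (auto simp: strong_limit_cardinal_def)

lemma Field_less: "|Field \<kappa>| <o \<theta>"
  using card_of_Field_ordIso[OF cardinals(3)] less by (rule ordIso_ordLess_trans)

lemma Pow_less: "|Pow (Field \<kappa>)| <o \<theta>"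
  by (rule strong_limit_Pow[OF \<theta> Field_less])

lemma Pow_le: "|X| \<le>o \<kappa> \<Longrightarrow> |Pow X| \<le>o |Pow (Field \<kappa>)|"
  using ordLeq_ordIso_trans[OF _ ordIso_symmetric[OF card_of_Field_ordIso[OF cardinals(3)]], of "|X|"]
  by (intro card_Pow_mono)

text \<open>
  A cofinal family \<open>X\<close> covers \<open>\<theta>\<close> by sets of size below \<open>\<kappa>\<close>, so \<open>|X| \<ge> \<theta> > 2\<^sup>\<kappa>\<close>. Since the power
  sets of its members cover \<open>PK \<kappa> \<theta>\<close> and each has at most \<open>2\<^sup>\<kappa>\<close> elements, \<open>|X|\<close> is the full
  cardinality.
\<close>

lemma card_PK_le_cofinal:
  assumes X: "X \<subseteq> PK \<kappa> \<theta>" and cof: "\<And>s. s \<in> PK \<kappa> \<theta> \<Longrightarrow> \<exists>x\<in>X. s \<subseteq> x"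
  shows "|PK \<kappa> \<theta>| \<le>o |X|" and "\<theta> \<le>o |X|"
proof -
  show le: "\<theta> \<le>o |X|"
  proof (rule ccontr)
    assume "\<not> \<theta> \<le>o |X|"
    then have Xl: "|X| <o \<theta>"
      using not_ordLeq_iff_ordLess[OF card_of_Well_order card_order_on_well_order_on[OF cardinals(4)]] by blast
    let ?Z = "X <+> Field \<kappa>"
    have "|?Z| <o \<theta>"
      using card_of_Plus_ordLess_infinite_Field[OF _ cardinals(4) Xl Field_less] cardinals(2)
      by (simp add: cinfinite_def)
    moreover have "\<theta> \<le>o |?Z|"
    proof -
      have sub: "Field \<theta> \<subseteq> (\<Union>x\<in>X. x)"
      proof
        fix a assume "a \<in> Field \<theta>"
        then have "{a} \<in> PK \<kappa> \<theta>" by (intro PK_finite[OF \<kappa>]) auto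
        then show "a \<in> (\<Union>x\<in>X. x)" using cof by blast
      qed
      have "|x| \<le>o |?Z|" if "x \<in> X" for x
      proof -
        have "|x| <o \<kappa>" using that X by (auto simp: PK_def)
        then have "|x| \<le>o \<kappa>" by (rule ordLess_imp_ordLeq)
        also have "\<kappa> =o |Field \<kappa>|" by (rule ordIso_symmetric[OF card_of_Field_ordIso[OF cardinals(3)]])
        also have "|Field \<kappa>| \<le>o |?Z|" by (rule card_of_Plus2)
        finally show ?thesis .
      qed
      moreover have "Cinfinite |?Z|"
        unfolding Cinfinite_card_of using cardinals(1) by (simp add: cinfinite_def)
      ultimately have "|\<Union>x\<in>X. x| \<le>o |?Z|"
        by (intro UNION_Cinfinite_bound) (auto simp: card_of_Plus1)
      from ordLeq_transitive[OF card_of_mono1[OF sub] this]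
      show ?thesis by (rule ordIso_ordLeq_trans[OF ordIso_symmetric[OF card_of_Field_ordIso[OF cardinals(4)]]])
    qed
    ultimately show False by (simp add: not_ordLess_ordLeq)
  qed
  have infX: "Cinfinite |X|"
    using cinfinite_mono[OF le] cardinals(2) by (simp add: card_of_Card_order)
  have "|Pow x| \<le>o |X|" if "x \<in> X" for x
  proof -
    have "|x| \<le>o \<kappa>" using that X by (auto simp: PK_def intro: ordLess_imp_ordLeq)
    then have "|Pow x| \<le>o |Pow (Field \<kappa>)|" by (rule Pow_le)
    also have "|Pow (Field \<kappa>)| <o \<theta>" by (rule Pow_less)
    also have "\<theta> \<le>o |X|" by (rule le)
    finally show ?thesis by (rule ordLess_imp_ordLeq)
  qed
  then have "|\<Union>x\<in>X. Pow x| \<le>o |X|"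
    using infX by (intro UNION_Cinfinite_bound) (auto intro: ordLeq_refl)
  moreover have "PK \<kappa> \<theta> \<subseteq> (\<Union>x\<in>X. Pow x)" using cof by blast
  ultimately show "|PK \<kappa> \<theta>| \<le>o |X|" using ordLeq_transitive[OF card_of_mono1] by blast
qed

lemma card_PK_le_stationary: "stationary \<kappa> \<theta> S \<Longrightarrow> |PK \<kappa> \<theta>| \<le>o |S|"
  using stationary_cofinal[OF \<kappa>] by (intro card_PK_le_cofinal) (auto simp: stationary_def)

lemma theta_le_PK: "\<theta> \<le>o |PK \<kappa> \<theta>|"
  by (rule card_PK_le_cofinal) auto

lemma Cinfinite_PK: "Cinfinite |PK \<kappa> \<theta>|"
  using cinfinite_mono[OF theta_le_PK] cardinals(2) by (simp add: card_of_Card_order)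

text \<open>
  The graph of a function from \<open>\<mu>\<close> to \<open>\<theta>\<close> is a set of size below \<open>\<kappa>\<close>, and \<open>\<mu> \<times> \<theta>\<close> embeds into \<open>\<theta>\<close>.
\<close>

lemma cexp_le_PK:
  fixes \<mu> :: "'b rel"
  assumes \<mu>: "Card_order \<mu>" "\<mu> <o \<kappa>"
  shows "\<theta> ^c \<mu> \<le>o |PK \<kappa> \<theta>|"
proof -
  have "|Field \<mu> \<times> Field \<theta>| \<le>o \<theta>"
    using cardinals(2) ordIso_imp_ordLeq[OF card_of_Field_ordIso[OF cardinals(4)]]
      ordLess_imp_ordLeq[OF ordIso_ordLess_trans[OF card_of_Field_ordIso[OF \<mu>(1)] ordLess_transitive[OF \<mu>(2) less]]]
    by (intro card_of_Times_ordLeq_infinite_Field) (auto simp: cinfinite_def)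
  then have "|Field \<mu> \<times> Field \<theta>| \<le>o |Field \<theta>|"
    by (rule ordLeq_ordIso_trans[OF _ ordIso_symmetric[OF card_of_Field_ordIso[OF cardinals(4)]]])
  then obtain p where p: "inj_on p (Field \<mu> \<times> Field \<theta>)" "p ` (Field \<mu> \<times> Field \<theta>) \<subseteq> Field \<theta>"
    using card_of_ordLeq[of "Field \<mu> \<times> Field \<theta>" "Field \<theta>"] by blast
  define g where "g f = (\<lambda>x. p (x, f x)) ` Field \<mu>" for f
  have "|Func (Field \<mu>) (Field \<theta>)| \<le>o |PK \<kappa> \<theta>|"
  proof (rule card_of_ordLeqI[of g])
    show "inj_on g (Func (Field \<mu>) (Field \<theta>))"
    proof (rule inj_onI, rule ext)
      fix f f' x assume f: "f \<in> Func (Field \<mu>) (Field \<theta>)" "f' \<in> Func (Field \<mu>) (Field \<theta>)" "g f = g f'"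
      show "f x = f' x"
      proof (cases "x \<in> Field \<mu>")
        case True
        then have "p (x, f x) \<in> g f'" using f(3) by (auto simp: g_def)
        then obtain y where y: "y \<in> Field \<mu>" "p (x, f x) = p (y, f' y)" by (auto simp: g_def)
        moreover have "(x, f x) \<in> Field \<mu> \<times> Field \<theta>" "(y, f' y) \<in> Field \<mu> \<times> Field \<theta>"
          using True y(1) f(1,2) by (auto simp: Func_def)
        ultimately have "(x, f x) = (y, f' y)" using p(1) by (simp only: inj_on_eq_iff)
        then show ?thesis by auto
      qed (use f in \<open>auto simp: Func_def\<close>)
    qed
    fix f assume f: "f \<in> Func (Field \<mu>) (Field \<theta>)"
    have "|g f| <o \<kappa>"
      unfolding g_def
      by (rule ordLeq_ordLess_trans[OF card_of_image ordIso_ordLess_trans[OF card_of_Field_ordIso[OF \<mu>(1)] \<mu>(2)]])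
    then show "g f \<in> PK \<kappa> \<theta>" using f p(2) by (auto simp: PK_def g_def Func_def)
  qed
  then show ?thesis by (simp add: cexp_def)
qed

text \<open>
  For the lower bound, every member of \<open>PK \<kappa> \<theta>\<close> is the range of a function on some
  \<open>B \<subseteq> \<kappa>\<close> with \<open>|B| < \<kappa>\<close>; there are at most \<open>2\<^sup>\<kappa> < \<theta>\<close> such \<open>B\<close>.
\<close>

lemma weak_power_eq_PK: "weak_power \<theta> \<kappa> =o |PK \<kappa> \<theta>|"
proof -
  let ?\<nu> = "weak_power \<theta> \<kappa>"
  note sup = is_card_sup_weak_power[of \<theta> \<kappa>]
  have \<nu>: "Card_order ?\<nu>" using sup by (simp add: is_card_sup_def)
  have ub: "\<theta> ^c |B| \<le>o ?\<nu>" if "|B| <o \<kappa>" for B :: "'b set"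
    using sup that card_of_Card_order[of B] unfolding is_card_sup_def by blast
  have le1: "?\<nu> \<le>o |PK \<kappa> \<theta>|"
    using cexp_le_PK by (intro is_card_sup_least[OF sup card_of_Card_order]) auto
  have \<theta>\<nu>: "\<theta> \<le>o ?\<nu>"
  proof -
    fix b :: 'b
    have "\<theta> \<le>o \<theta> ^c |{b}|"
      by (rule ordLeq_cexp1) (auto simp: cardinals(4) card_of_card_order_on Field_card_of card_of_ordIso_czero_iff_empty)
    moreover have "|{b}| <o \<kappa>" by (rule finite_less_regular[OF \<kappa>]) simp
    ultimately show ?thesis using ub ordLeq_transitive by blast
  qed
  have \<nu>inf: "Cinfinite ?\<nu>" using cinfinite_mono[OF \<theta>\<nu>] cardinals(2) \<nu> by simp
  let ?I = "{B. B \<subseteq> Field \<kappa> \<and> |B| <o \<kappa>}"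
  have "|?I| \<le>o |Pow (Field \<kappa>)|" by (rule card_of_mono1) auto
  then have I: "|?I| \<le>o ?\<nu>"
    using ordLeq_transitive[OF _ ordLeq_transitive[OF ordLess_imp_ordLeq[OF Pow_less] \<theta>\<nu>]] by blast
  have "|(\<lambda>f. f ` B) ` Func B (Field \<theta>)| \<le>o ?\<nu>" if "B \<in> ?I" for B
    using ordLeq_transitive[OF card_of_image, of "Func B (Field \<theta>)" "?\<nu>"] ub[of B] that
    by (simp add: cexp_def Field_card_of)
  then have "|\<Union>B\<in>?I. (\<lambda>f. f ` B) ` Func B (Field \<theta>)| \<le>o ?\<nu>"
    by (intro UNION_Cinfinite_bound[OF I _ \<nu>inf]) blast
  moreover have "PK \<kappa> \<theta> \<subseteq> (\<Union>B\<in>?I. (\<lambda>f. f ` B) ` Func B (Field \<theta>))"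
  proof
    fix s assume s: "s \<in> PK \<kappa> \<theta>"
    then obtain B where B: "B \<subset> Field \<kappa>" "|s| =o |B|" "|B| <o \<kappa>"
      using internalize_card_of_ordLess[of s \<kappa>] by (auto simp: PK_def)
    obtain f where f: "bij_betw f B s"
      using ordIso_symmetric[OF B(2)] card_of_ordIso[of B s] by blast
    define h where "h x = (if x \<in> B then f x else undefined)" for x
    have "h ` B = s" using f by (auto simp: h_def bij_betw_def)
    moreover have "h \<in> Func B (Field \<theta>)" using f s by (auto simp: h_def Func_def bij_betw_def PK_def)
    ultimately have "s \<in> (\<lambda>f. f ` B) ` Func B (Field \<theta>)" by blast
    then show "s \<in> (\<Union>B\<in>?I. (\<lambda>f. f ` B) ` Func B (Field \<theta>))" using B by blast
  qed
  ultimately have "|PK \<kappa> \<theta>| \<le>o ?\<nu>" using ordLeq_transitive[OF card_of_mono1] by blast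
  then show ?thesis using le1 by (simp add: ordIso_iff_ordLeq)
qed

end

section \<open>Guessing operations and splitting\<close>

text \<open>
  Splitting into pieces indexed by \<open>J\<close>, phrased by a colouring: disjointness is then automatic, and
  the points whose colour lies outside \<open>J\<close> are the part of \<open>S\<close> that is left over.
\<close>

definition splits :: "'b rel \<Rightarrow> 'a rel \<Rightarrow> 'a set set \<Rightarrow> 'j set \<Rightarrow> bool" where
  "splits \<kappa> \<theta> S J \<longleftrightarrow> (\<exists>\<chi>. \<forall>j\<in>J. stationary \<kappa> \<theta> {s \<in> S. \<chi> s = j})"

lemma splits_image:
  assumes "splits \<kappa> \<theta> S J'" and "S \<subseteq> PK \<kappa> \<theta>" and J: "J \<subseteq> f ` J'"
  shows "splits \<kappa> \<theta> S J"
proof -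
  obtain \<chi> where \<chi>: "\<forall>j\<in>J'. stationary \<kappa> \<theta> {s \<in> S. \<chi> s = j}"
    using assms(1) by (auto simp: splits_def)
  have "stationary \<kappa> \<theta> {s \<in> S. f (\<chi> s) = j}" if j: "j \<in> J" for j
  proof -
    obtain j' where j': "j' \<in> J'" "j = f j'" using subsetD[OF J j] by blast
    with \<chi> have "stationary \<kappa> \<theta> {s \<in> S. \<chi> s = j'}" by blast
    then show ?thesis using j' assms(2) by (rule_tac stationary_mono) auto
  qed
  then show ?thesis unfolding splits_def by (intro exI[of _ "f \<circ> \<chi>"]) simp
qed

abbreviation maps_lists :: "'a rel \<Rightarrow> ('a list \<Rightarrow> 'a list) \<Rightarrow> bool" where
  "maps_lists \<theta> F \<equiv> \<forall>l\<in>lists (Field \<theta>). F l \<in> lists (Field \<theta>)"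

text \<open>
  For an injection \<open>k\<close> of \<open>\<kappa>\<close> into \<open>\<theta>\<close>, closure of \<open>s\<close> under \<open>below \<kappa> k\<close> says that the preimage of \<open>s\<close>
  under \<open>k\<close> is an initial segment of \<open>\<kappa>\<close>; it plays the role of the usual condition
  \<open>s \<inter> \<kappa> \<in> \<kappa>\<close>.
\<close>

definition below :: "'b rel \<Rightarrow> ('b \<Rightarrow> 'a) \<Rightarrow> 'a list \<Rightarrow> 'a set" where
  "below \<kappa> k l = (\<Union>i\<in>{i \<in> Field \<kappa>. k i \<in> set l}. k ` underS \<kappa> i)"

context strong_limit_PK
begin

lemma below_in_PK:
  assumes k: "inj_on k (Field \<kappa>)" "k ` Field \<kappa> \<subseteq> Field \<theta>"
  shows "below \<kappa> k l \<in> PK \<kappa> \<theta>"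
  unfolding below_def
proof (rule PK_UN[OF \<kappa>])
  have "inj_on k {i \<in> Field \<kappa>. k i \<in> set l}" using k(1) by (rule inj_on_subset) auto
  moreover have "finite (k ` {i \<in> Field \<kappa>. k i \<in> set l})"
    by (rule finite_subset[of _ "set l"]) auto
  ultimately have "finite {i \<in> Field \<kappa>. k i \<in> set l}" by (simp add: finite_image_iff)
  then show "|{i \<in> Field \<kappa>. k i \<in> set l}| <o \<kappa>" by (rule finite_less_regular[OF \<kappa>])
next
  fix i assume "i \<in> {i \<in> Field \<kappa>. k i \<in> set l}"
  then have "|underS \<kappa> i| <o \<kappa>" by (intro card_of_underS[OF cardinals(3)]) simp
  then have "|k ` underS \<kappa> i| <o \<kappa>" by (rule ordLeq_ordLess_trans[OF card_of_image])
  then show "k ` underS \<kappa> i \<in> PK \<kappa> \<theta>"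
    using k(2) underS_Field[of _ \<kappa> i] by (auto simp: PK_def)
qed

lemma enumerate_small_set:
  assumes s: "s \<in> PK \<kappa> \<theta>"
  shows "\<exists>i e. i \<in> Field \<kappa> \<and> range e \<subseteq> Field \<theta> \<and> s \<subseteq> e ` underS \<kappa> i"
proof -
  obtain x0 where x0: "x0 \<in> Field \<theta>" using cardinals(2) by (fastforce simp: cinfinite_def)
  have "|s| <o \<kappa>" using s by (simp add: PK_def)
  then obtain i where i: "i \<in> Field \<kappa>" "|s| =o Restr \<kappa> (underS \<kappa> i)"
    using ordLess_iff_ordIso_Restr[OF card_order_on_well_order_on[OF cardinals(3)] card_of_Well_order, of s] by blast
  let ?R = "Field (Restr \<kappa> (underS \<kappa> i))"
  have "|?R| =o |s|" using ordIso_symmetric[OF card_of_cong[OF i(2)]] by (simp add: Field_card_of)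
  then obtain f where f: "bij_betw f ?R s" using card_of_ordIso[of ?R s] by blast
  define e where "e x = (if x \<in> ?R then f x else x0)" for x
  have "?R \<subseteq> underS \<kappa> i" by (auto simp: Field_def)
  then have "s \<subseteq> e ` underS \<kappa> i" using f by (force simp: e_def bij_betw_def)
  moreover have "range e \<subseteq> Field \<theta>" using f s x0 by (auto simp: e_def bij_betw_def PK_def)
  ultimately show ?thesis using i(1) by blast
qed

text \<open>
  Replaces operations whose values are small sets by operations whose values are lists. The set
  \<open>G l\<close> is listed by a function \<open>e l\<close> on an initial segment \<open>\<eta> l\<close> of \<open>\<kappa>\<close>. If \<open>s\<close> contains (the
  image of) \<open>\<eta> l\<close> and is closed under \<open>below \<kappa> k\<close>, it contains all smaller indices, so closure of \<open>s\<close>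
  under evaluation of \<open>e l\<close> at an index yields \<open>G l \<subseteq> s\<close>.
\<close>

lemma club_contains_finitary:
  assumes k: "inj_on k (Field \<kappa>)" "k ` Field \<kappa> \<subseteq> Field \<theta>" and C: "club \<kappa> \<theta> C"
  shows "\<exists>F. maps_lists \<theta> F \<and>
    {s \<in> PK \<kappa> \<theta>. closed_under (below \<kappa> k) s \<and> closed_under (set \<circ> F) s} \<subseteq> C"
proof -
  obtain G where G: "\<forall>l\<in>lists (Field \<theta>). G l \<in> PK \<kappa> \<theta>" "{s \<in> PK \<kappa> \<theta>. closed_under G s} \<subseteq> C"
    using club_contains_closed_under[OF \<kappa> C] by blast
  have "\<forall>l\<in>lists (Field \<theta>). \<exists>p. fst p \<in> Field \<kappa> \<and> range (snd p) \<subseteq> Field \<theta> \<and> G l \<subseteq> snd p ` underS \<kappa> (fst p)"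
    using G(1) enumerate_small_set by fastforce
  from bchoice[OF this] obtain p where p: "\<forall>l\<in>lists (Field \<theta>). fst (p l) \<in> Field \<kappa> \<and>
      range (snd (p l)) \<subseteq> Field \<theta> \<and> G l \<subseteq> snd (p l) ` underS \<kappa> (fst (p l))" ..
  \<comment> \<open>The first entry yields the length of the enumeration of G l; the second one reads l as an
     index followed by a list and evaluates the enumeration belonging to that list.\<close>
  define F where "F l = k (fst (p l)) #
    (case l of [] \<Rightarrow> [] | x # l' \<Rightarrow> [snd (p l') (the_inv_into (Field \<kappa>) k x)])" for l
  have "maps_lists \<theta> F"
  proof
    fix l assume l: "l \<in> lists (Field \<theta>)"
    then have "k (fst (p l)) \<in> Field \<theta>" using p k(2) by blast
    moreover have "snd (p l') x \<in> Field \<theta>" if "l' \<in> lists (Field \<theta>)" for l' x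
      using p that by blast
    ultimately show "F l \<in> lists (Field \<theta>)" using l
      by (cases l) (simp_all add: F_def)
  qed
  moreover have "s \<in> C"
    if s: "s \<in> PK \<kappa> \<theta>" "closed_under (below \<kappa> k) s" "closed_under (set \<circ> F) s" for s
  proof -
    have "G l \<subseteq> s" if l: "l \<in> lists s" for l
    proof
      fix y assume y: "y \<in> G l"
      have l\<theta>: "l \<in> lists (Field \<theta>)" using l s(1) by (auto simp: PK_def)
      then obtain i where i: "i \<in> underS \<kappa> (fst (p l))" "y = snd (p l) i" using p y by blast
      have \<eta>: "fst (p l) \<in> Field \<kappa>" using p l\<theta> by blast
      have "k (fst (p l)) \<in> s" using s(3) l by (auto simp: closed_under_def F_def)
      then have "below \<kappa> k [k (fst (p l))] \<subseteq> s" using s(2) by (simp add: closed_under_def)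
      then have "k i \<in> s" using i(1) \<eta> by (auto simp: below_def)
      then have "k i # l \<in> lists s" using l by simp
      then have "set (F (k i # l)) \<subseteq> s" using s(3) by (simp add: closed_under_def)
      moreover have "the_inv_into (Field \<kappa>) k (k i) = i"
        using k(1) underS_Field[OF i(1)] by (rule the_inv_into_f_f)
      ultimately show "y \<in> s" using i(2) by (simp add: F_def)
    qed
    then have "closed_under G s" by (simp add: closed_under_def)
    then show ?thesis using G(2) s(1) by blast
  qed
  ultimately show ?thesis by (intro exI[of _ F]) auto
qed

text \<open>
  A list \<open>l\<close> is recorded at \<open>d\<close> only if \<open>F l\<close> lies below \<open>d\<close> as well. Hence the traces at \<open>d\<close> are
  partial operations on the initial segment below \<open>d\<close>, and there are fewer than \<open>\<theta>\<close> of them.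
\<close>

definition trace :: "('a list \<Rightarrow> 'a list) \<Rightarrow> 'a \<Rightarrow> ('a list \<times> 'a list) set" where
  "trace F d = {(l, F l) | l. set l \<union> set (F l) \<subseteq> underS \<theta> d}"

lemma traces_codable:
  assumes D: "D \<subseteq> Field \<theta>"
  shows "\<exists>code. code ` (\<Union>d\<in>D. range (\<lambda>F. trace F d)) \<subseteq> Field \<theta> \<and>
    inj_on code (\<Union>d\<in>D. range (\<lambda>F. trace F d))"
proof -
  have unc: "natLeq <o \<theta>" using regular_uncountableD(2)[OF \<kappa>] less by (rule ordLess_transitive)
  have "|range (\<lambda>F. trace F d)| \<le>o \<theta>" if "d \<in> D" for d
  proof -
    let ?L = "lists (underS \<theta> d)"
    have "|underS \<theta> d| <o \<theta>" using that D by (intro card_of_underS[OF cardinals(4)]) auto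
    then have L: "|?L| <o \<theta>" by (rule card_lists_less[OF cardinals(4) unc])
    have "|?L \<times> ?L| <o \<theta>"
    proof (cases "finite ?L")
      case True
      then have "finite (?L \<times> ?L)" by simp
      then have "|?L \<times> ?L| <o natLeq" by (simp only: finite_iff_ordLess_natLeq)
      then show ?thesis using unc by (rule ordLess_transitive)
    next
      case False
      then show ?thesis by (rule ordIso_ordLess_trans[OF card_of_Times_same_infinite L])
    qed
    then have "|Pow (?L \<times> ?L)| <o \<theta>" by (rule strong_limit_Pow[OF \<theta>])
    moreover have "range (\<lambda>F. trace F d) \<subseteq> Pow (?L \<times> ?L)"
      unfolding trace_def lists_eq_set by blast
    ultimately have "|range (\<lambda>F. trace F d)| <o \<theta>"
      by (rule ordLeq_ordLess_trans[OF card_of_mono1, rotated])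
    then show ?thesis by (rule ordLess_imp_ordLeq)
  qed
  moreover have "|D| \<le>o \<theta>"
    using ordLeq_ordIso_trans[OF card_of_mono1[OF D] card_of_Field_ordIso[OF cardinals(4)]] .
  ultimately have "|\<Union>d\<in>D. range (\<lambda>F. trace F d)| \<le>o \<theta>"
    using cardinals(2) by (intro UNION_Cinfinite_bound) auto
  then have "|\<Union>d\<in>D. range (\<lambda>F. trace F d)| \<le>o |Field \<theta>|"
    by (rule ordLeq_ordIso_trans[OF _ ordIso_symmetric[OF card_of_Field_ordIso[OF cardinals(4)]]])
  then show ?thesis using card_of_ordLeq[of "\<Union>d\<in>D. range (\<lambda>F. trace F d)" "Field \<theta>"] by blast
qed

lemma lists_bounded:
  assumes D: "D \<subseteq> Field \<theta>" and cof: "cofinal D \<theta>" and l: "l \<in> lists (Field \<theta>)"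
  shows "\<exists>d\<in>D. set l \<subseteq> underS \<theta> d"
proof -
  have sub: "Field \<theta> \<subseteq> (\<Union>d\<in>D. underS \<theta> d)" using cof by (auto simp: cofinal_def underS_def)
  have wo: "Well_order \<theta>" by (rule card_order_on_well_order_on[OF cardinals(4)])
  have "\<exists>d\<in>D. l \<in> lists (underS \<theta> d)"
  proof (rule list_in_directed_union)
    show "D \<noteq> {}" using sub cardinals(2) by (auto simp: cinfinite_def)
    show "\<exists>k\<in>D. underS \<theta> i \<union> underS \<theta> j \<subseteq> underS \<theta> k" if "i \<in> D" "j \<in> D" for i j
    proof -
      have "underS \<theta> i \<subseteq> underS \<theta> j \<or> underS \<theta> j \<subseteq> underS \<theta> i"
      proof (cases "i = j")
        case False
        then have "(i, j) \<in> \<theta> \<or> (j, i) \<in> \<theta>"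
          using wo that D by (auto simp: well_order_on_def linear_order_on_def total_on_def)
        then show ?thesis
          using wo underS_incr[of \<theta> i j] underS_incr[of \<theta> j i] by (auto simp: order_on_defs)
      qed simp
      then show ?thesis using that by blast
    qed
    show "l \<in> lists (\<Union>d\<in>D. underS \<theta> d)" using l sub lists_mono by blast
  qed
  then show ?thesis by (auto simp: lists_eq_set)
qed

text \<open>
  The heart of the proof. For an operation \<open>F\<close> and \<open>A \<subseteq> D\<close>, \<open>guess F A\<close> is the map sending \<open>d \<in> A\<close> to the
  code of the trace of \<open>F\<close> at \<open>d\<close>, as a set of pairs, so that its domain and its containment in
  \<open>s \<times> s\<close> can be read off. A set \<open>s\<close> is put into \<open>B g\<close> if \<open>g\<close> is the guess of some \<open>F\<close> on \<open>s \<inter> D\<close>,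
  where \<open>s\<close> is closed under \<open>F\<close> and under \<open>l \<mapsto> m (F l @ l)\<close>, an element of \<open>D\<close> above \<open>l\<close> and \<open>F l\<close>.
  The latter ensures that the traces at the points of \<open>s \<inter> D\<close> determine \<open>F\<close> on all lists over \<open>s\<close>.

  The hypothesis \<open>small\<close> is what forces, for every \<open>F\<close>, one of the sets \<open>B (guess F A)\<close> to have at
  least \<open>|J|\<close> elements.
\<close>

lemma splits_if_small_unions:
  fixes J :: "'j set"
  assumes D: "D \<subseteq> Field \<theta>" and cof: "cofinal D \<theta>"
    and S: "stationary \<kappa> \<theta> S"
    and J: "infinite J" "|Pow (Field \<kappa>)| \<le>o |J|"
    and small: "\<And>Y :: 'a set \<Rightarrow> 'a set set.
      \<forall>A\<in>Pow D. |Y A| <o |J| \<Longrightarrow> |\<Union>A\<in>Pow D. Y A| <o |PK \<kappa> \<theta>|"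
  shows "splits \<kappa> \<theta> S J"
proof -
  have SPK: "S \<subseteq> PK \<kappa> \<theta>" using S by (simp add: stationary_def)
  have "|Field \<kappa>| \<le>o |Field \<theta>|"
    using ordLess_imp_ordLeq[OF less] by (rule card_of_mono2)
  then obtain k where k: "inj_on k (Field \<kappa>)" "k ` Field \<kappa> \<subseteq> Field \<theta>"
    using card_of_ordLeq[of "Field \<kappa>" "Field \<theta>"] by blast
  obtain code where code: "code ` (\<Union>d\<in>D. range (\<lambda>F. trace F d)) \<subseteq> Field \<theta>"
    "inj_on code (\<Union>d\<in>D. range (\<lambda>F. trace F d))"
    using traces_codable[OF D] by blast
  have "\<forall>l\<in>lists (Field \<theta>). \<exists>d. d \<in> D \<and> set l \<subseteq> underS \<theta> d"
    using lists_bounded[OF D cof] by blast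
  from bchoice[OF this] obtain m
    where m: "\<forall>l\<in>lists (Field \<theta>). m l \<in> D \<and> set l \<subseteq> underS \<theta> (m l)" ..
  define guess where "guess F A = {(d, code (trace F d)) | d. d \<in> A}" for F A
  define B where "B g = {s \<in> S. closed_under (below \<kappa> k) s \<and> g \<subseteq> s \<times> s \<and>
    (\<exists>F. maps_lists \<theta> F \<and> closed_under (set \<circ> F) s \<and> closed_under (\<lambda>l. {m (F l @ l)}) s \<and>
      g = guess F (s \<inter> D))}" for g

  \<comment> \<open>An operation H with the same guess as F agrees with F on lists over s.\<close>
  have B_closed: "closed_under (set \<circ> F) s" if A: "A \<subseteq> D" and s: "s \<in> B (guess F A)" for F A s
  proof -
    obtain H where H: "maps_lists \<theta> H" "closed_under (set \<circ> H) s"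
      "closed_under (\<lambda>l. {m (H l @ l)}) s" "guess F A = guess H (s \<inter> D)"
      using s by (auto simp: B_def)
    have s\<theta>: "s \<subseteq> Field \<theta>" using s SPK by (auto simp: B_def PK_def)
    have tr: "trace F d = trace H d" if "d \<in> s \<inter> D" for d
    proof -
      have "(d, code (trace H d)) \<in> guess F A" using that H(4) by (auto simp: guess_def)
      then have "code (trace H d) = code (trace F d)" by (auto simp: guess_def)
      then show ?thesis using inj_onD[OF code(2), of "trace H d" "trace F d"] that by auto
    qed
    have "set (F l) \<subseteq> s" if l: "l \<in> lists s" for l
    proof -
      let ?d = "m (H l @ l)"
      have Hl: "set (H l) \<subseteq> s" and d: "?d \<in> s" using H(2,3) l by (auto simp: closed_under_def)
      then have "H l @ l \<in> lists (Field \<theta>)" using l s\<theta> by (auto simp: lists_eq_set)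
      then have "?d \<in> D" "set (H l @ l) \<subseteq> underS \<theta> ?d" using m by blast+
      then have "(l, H l) \<in> trace H ?d" by (auto simp: trace_def)
      then have "(l, H l) \<in> trace F ?d" using tr d \<open>?d \<in> D\<close> by simp
      then have "F l = H l" by (auto simp: trace_def)
      then show ?thesis using Hl by simp
    qed
    then show ?thesis by (simp add: closed_under_def)
  qed

  define I where "I = {g. |J| \<le>o |B g|}"
  have "\<exists>\<chi>. \<forall>g\<in>I. \<forall>j\<in>J. \<exists>s\<in>B g. \<chi> s = j"
  proof (rule rainbow_colouring[OF J(1)])
    show "|J| \<le>o |B g|" if "g \<in> I" for g using that by (simp add: I_def)
    show "|{g \<in> I. s \<in> B g}| \<le>o |J|" for s
    proof (cases "s \<in> S")
      case True
      then have "|s| <o \<kappa>" using SPK by (auto simp: PK_def)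
      then have "|s \<times> s| \<le>o \<kappa>"
        using cardinals(1) by (intro card_of_Times_ordLeq_infinite_Field) (auto simp: cinfinite_def intro: ordLess_imp_ordLeq)
      then have "|Pow (s \<times> s)| \<le>o |J|" using Pow_le J(2) ordLeq_transitive by blast
      moreover have "{g \<in> I. s \<in> B g} \<subseteq> Pow (s \<times> s)" by (auto simp: B_def)
      ultimately show ?thesis using ordLeq_transitive[OF card_of_mono1] by blast
    next
      case False
      then have "{g \<in> I. s \<in> B g} = {}" by (auto simp: B_def)
      then show ?thesis by (simp only: card_of_empty)
    qed
  qed
  then obtain \<chi> where \<chi>: "\<And>g j. g \<in> I \<Longrightarrow> j \<in> J \<Longrightarrow> \<exists>s\<in>B g. \<chi> s = j" by blast

  have big: "\<exists>A\<in>Pow D. |J| \<le>o |B (guess F A)|" if F: "maps_lists \<theta> F" for F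
  proof (rule ccontr)
    assume "\<not> ?thesis"
    then have "\<forall>A\<in>Pow D. |B (guess F A)| <o |J|"
      using not_ordLeq_iff_ordLess[OF card_of_Well_order card_of_Well_order] by blast
    then have Y: "|\<Union>A\<in>Pow D. B (guess F A)| <o |PK \<kappa> \<theta>|" by (rule small)
    \<comment> \<open>If s is closed under G, then s guesses F on \<open>s \<inter> D\<close> with F itself as the witness.\<close>
    define G where "G l = below \<kappa> k l \<union> (set (F l) \<union> insert (m (F l @ l))
      ((\<lambda>d. code (trace F d)) ` (set l \<inter> D)))" for l
    have "stationary \<kappa> \<theta> {s \<in> S. closed_under G s}"
    proof (rule stationary_Int_closed_under[OF \<kappa> S])
      fix l assume l: "l \<in> lists (Field \<theta>)"
      have fin: "finite (set (F l) \<union> insert (m (F l @ l)) ((\<lambda>d. code (trace F d)) ` (set l \<inter> D)))"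
        by simp
      have "code (trace F d) \<in> Field \<theta>" if "d \<in> D" for d using code(1) that by blast
      moreover have Fl: "F l \<in> lists (Field \<theta>)" using F l by blast
      moreover have "m (F l @ l) \<in> Field \<theta>"
      proof -
        have "F l @ l \<in> lists (Field \<theta>)" using Fl l by simp
        then show ?thesis using m D by blast
      qed
      ultimately have "set (F l) \<union> insert (m (F l @ l)) ((\<lambda>d. code (trace F d)) ` (set l \<inter> D)) \<subseteq> Field \<theta>"
        by auto
      then show "G l \<in> PK \<kappa> \<theta>"
        unfolding G_def by (rule PK_Un[OF \<kappa> below_in_PK[OF k] PK_finite[OF \<kappa> fin]])
    qed
    then have "|PK \<kappa> \<theta>| \<le>o |{s \<in> S. closed_under G s}|" by (rule card_PK_le_stationary)
    moreover have "{s \<in> S. closed_under G s} \<subseteq> (\<Union>A\<in>Pow D. B (guess F A))"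
    proof
      fix s assume s: "s \<in> {s \<in> S. closed_under G s}"
      then have cl: "closed_under (below \<kappa> k) s" "closed_under (set \<circ> F) s"
        "closed_under (\<lambda>l. {m (F l @ l)}) s" by (auto simp: closed_under_def G_def)
      have "code (trace F d) \<in> s" if "d \<in> s \<inter> D" for d
      proof -
        have "G [d] \<subseteq> s" using s that by (auto simp: closed_under_def)
        then show ?thesis using that by (auto simp: G_def)
      qed
      then have "guess F (s \<inter> D) \<subseteq> s \<times> s" by (auto simp: guess_def)
      then have "s \<in> B (guess F (s \<inter> D))" using s cl F by (auto simp: B_def)
      then show "s \<in> (\<Union>A\<in>Pow D. B (guess F A))" by blast
    qed
    ultimately have "|PK \<kappa> \<theta>| \<le>o |\<Union>A\<in>Pow D. B (guess F A)|"
      by (rule ordLeq_transitive[OF _ card_of_mono1])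
    then show False using Y not_ordLess_ordLeq by blast
  qed

  have "stationary \<kappa> \<theta> {s \<in> S. \<chi> s = j}" if j: "j \<in> J" for j
    unfolding stationary_def
  proof (intro conjI allI impI)
    show "{s \<in> S. \<chi> s = j} \<subseteq> PK \<kappa> \<theta>" using SPK by blast
    fix C assume "club \<kappa> \<theta> C"
    then obtain F where F: "maps_lists \<theta> F"
      "{s \<in> PK \<kappa> \<theta>. closed_under (below \<kappa> k) s \<and> closed_under (set \<circ> F) s} \<subseteq> C"
      using club_contains_finitary[OF k] by blast
    obtain A where A: "A \<subseteq> D" "guess F A \<in> I" using big[OF F(1)] by (auto simp: I_def)
    then obtain s where s: "s \<in> B (guess F A)" "\<chi> s = j" using \<chi> j by blast
    then have "s \<in> S" "closed_under (below \<kappa> k) s" by (auto simp: B_def)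
    then show "{s \<in> S. \<chi> s = j} \<inter> C \<noteq> {}" using F(2) B_closed[OF A(1) s(1)] SPK s(2) by blast
  qed
  then show ?thesis by (auto simp: splits_def)
qed

end

section \<open>Splitting into maximally many stationary sets\<close>

context strong_limit_PK
begin

text \<open>
  Enlarging \<open>J\<close> to \<open>J <+> Pow \<kappa>\<close> keeps it below \<open>|PK \<kappa> \<theta>|\<close> and makes it large enough for the
  degree bound; the additional colours are merged afterwards.
\<close>

lemma splits_small:
  fixes J :: "'j set"
  assumes D: "D \<subseteq> Field \<theta>" "cofinal D \<theta>" "|D| <o \<theta>"
    and S: "stationary \<kappa> \<theta> S" and J: "|J| <o |PK \<kappa> \<theta>|"
  shows "splits \<kappa> \<theta> S J"
proof -
  have SPK: "S \<subseteq> PK \<kappa> \<theta>" using S by (simp add: stationary_def)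
  have infPK: "infinite (PK \<kappa> \<theta>)" using Cinfinite_PK Cinfinite_card_of by blast
  let ?J = "J <+> Pow (Field \<kappa>)"
  have infJ: "infinite ?J" using cardinals(1) by (simp add: cinfinite_def)
  have J': "|?J| <o |PK \<kappa> \<theta>|"
    by (rule card_of_Plus_ordLess_infinite[OF infPK J ordLess_ordLeq_trans[OF Pow_less theta_le_PK]])
  have PowD: "|Pow D| <o |PK \<kappa> \<theta>|"
    by (rule ordLess_ordLeq_trans[OF strong_limit_Pow[OF \<theta> D(3)] theta_le_PK])
  have "splits \<kappa> \<theta> S ?J"
  proof (rule splits_if_small_unions[OF D(1,2) S infJ card_of_Plus2])
    fix Y :: "'a set \<Rightarrow> 'a set set"
    assume Y: "\<forall>A\<in>Pow D. |Y A| <o |?J|"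
    let ?Z = "?J <+> Pow D"
    have "|Y A| \<le>o |?Z|" if "A \<in> Pow D" for A
      using ordLeq_transitive[OF ordLess_imp_ordLeq card_of_Plus1] Y that by blast
    moreover have "Cinfinite |?Z|" unfolding Cinfinite_card_of using infJ by (simp only: finite_Plus_iff simp_thms)
    ultimately have "|\<Union>A\<in>Pow D. Y A| \<le>o |?Z|"
      by (intro UNION_Cinfinite_bound[OF card_of_Plus2]) blast
    then show "|\<Union>A\<in>Pow D. Y A| <o |PK \<kappa> \<theta>|"
      by (rule ordLeq_ordLess_trans[OF _ card_of_Plus_ordLess_infinite[OF infPK J' PowD]])
  qed
  moreover have "J \<subseteq> case_sum id (\<lambda>_. undefined) ` ?J" by force
  ultimately show ?thesis by (rule splits_image[OF _ SPK])
qed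

lemma splits_regular:
  assumes D: "D \<subseteq> Field \<theta>" "cofinal D \<theta>" "|D| <o \<theta>"
    and S: "stationary \<kappa> \<theta> S" and reg: "regularCard |PK \<kappa> \<theta>|"
  shows "splits \<kappa> \<theta> S (PK \<kappa> \<theta>)"
proof (rule splits_if_small_unions[OF D(1,2) S])
  show "infinite (PK \<kappa> \<theta>)" using Cinfinite_PK Cinfinite_card_of by blast
  show "|Pow (Field \<kappa>)| \<le>o |PK \<kappa> \<theta>|"
    by (rule ordLess_imp_ordLeq[OF ordLess_ordLeq_trans[OF Pow_less theta_le_PK]])
  show "|\<Union>A\<in>Pow D. Y A| <o |PK \<kappa> \<theta>|" if "\<forall>A\<in>Pow D. |Y A| <o |PK \<kappa> \<theta>|" for Y :: "'a set \<Rightarrow> 'a set set"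
    by (rule card_of_UNION_ordLess_infinite_Field_regularCard[OF reg Cinfinite_PK
          ordLess_ordLeq_trans[OF strong_limit_Pow[OF \<theta> D(3)] theta_le_PK] that])
qed

text \<open>
  Split first into pieces indexed by a cofinal subset \<open>K\<close> of the cardinal, then split the piece of
  \<open>j \<in> K\<close> into as many pieces as there are elements below \<open>j\<close>. A final colour \<open>i\<close> occurs stationarily
  often in the piece of any \<open>j \<in> K\<close> above \<open>i\<close>.
\<close>

lemma splits_singular:
  assumes D: "D \<subseteq> Field \<theta>" "cofinal D \<theta>" "|D| <o \<theta>"
    and S: "stationary \<kappa> \<theta> S" and sing: "\<not> regularCard |PK \<kappa> \<theta>|"
  shows "splits \<kappa> \<theta> S (PK \<kappa> \<theta>)"
proof -
  let ?P = "PK \<kappa> \<theta>"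
  have SPK: "S \<subseteq> ?P" using S by (simp add: stationary_def)
  obtain K where K: "K \<subseteq> ?P" "cofinal K |?P|" "\<not> |K| =o |?P|"
    using sing by (auto simp: regularCard_def Field_card_of)
  then have "|K| <o |?P|"
    using card_of_mono1[OF K(1)] by (simp add: ordLeq_iff_ordLess_or_ordIso)
  then have "splits \<kappa> \<theta> S K" by (rule splits_small[OF D S])
  then obtain \<chi> where \<chi>: "\<forall>j\<in>K. stationary \<kappa> \<theta> {s \<in> S. \<chi> s = j}"
    by (auto simp: splits_def)
  have "\<exists>\<psi>. \<forall>i\<in>underS |?P| j. stationary \<kappa> \<theta> {s \<in> {s \<in> S. \<chi> s = j}. \<psi> s = i}" if j: "j \<in> K" for j
  proof -
    have "|underS |?P| j| <o |?P|"
      using j K(1) by (intro card_of_underS[OF card_of_Card_order]) (auto simp: Field_card_of)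
    then have "splits \<kappa> \<theta> {s \<in> S. \<chi> s = j} (underS |?P| j)"
      using \<chi> j by (intro splits_small[OF D]) blast+
    then show ?thesis by (simp add: splits_def)
  qed
  then have "\<forall>j\<in>K. \<exists>\<psi>. \<forall>i\<in>underS |?P| j. stationary \<kappa> \<theta> {s \<in> {s \<in> S. \<chi> s = j}. \<psi> s = i}" by blast
  from bchoice[OF this] obtain \<psi> where
    \<psi>: "\<forall>j\<in>K. \<forall>i\<in>underS |?P| j. stationary \<kappa> \<theta> {s \<in> {s \<in> S. \<chi> s = j}. \<psi> j s = i}" ..
  have "stationary \<kappa> \<theta> {s \<in> S. \<psi> (\<chi> s) s = i}" if i: "i \<in> ?P" for i
  proof -
    obtain j where "j \<in> K" "i \<noteq> j" "(i, j) \<in> |?P|"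
      using K(2) i by (auto simp: cofinal_def Field_card_of)
    then have "stationary \<kappa> \<theta> {s \<in> {s \<in> S. \<chi> s = j}. \<psi> j s = i}" using \<psi> by (auto simp: underS_def)
    then show ?thesis by (rule stationary_mono) (use SPK in auto)
  qed
  then show ?thesis unfolding splits_def by (intro exI[of _ "\<lambda>s. \<psi> (\<chi> s) s"]) blast
qed

end

text \<open>
  The part of \<open>S\<close> without a colour in \<open>J\<close> is added to one of the pieces.
\<close>

lemma partition_if_splits:
  assumes \<kappa>: "regular_uncountable \<kappa>" and S: "S \<subseteq> PK \<kappa> \<theta>" and "splits \<kappa> \<theta> S J" and nonempty: "J \<noteq> {}"
  shows "\<exists>Q. partition_on S Q \<and> (\<forall>X\<in>Q. stationary \<kappa> \<theta> X) \<and> |Q| =o |J|"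
proof -
  obtain \<chi> where \<chi>: "\<forall>j\<in>J. stationary \<kappa> \<theta> {s \<in> S. \<chi> s = j}"
    using assms(3) by (auto simp: splits_def)
  obtain j0 where j0: "j0 \<in> J" using nonempty by blast
  define \<psi> where "\<psi> s = (if \<chi> s \<in> J then \<chi> s else j0)" for s
  define X where "X j = {s \<in> S. \<psi> s = j}" for j
  have stat: "stationary \<kappa> \<theta> (X j)" if j: "j \<in> J" for j
  proof (rule stationary_mono)
    show "stationary \<kappa> \<theta> {s \<in> S. \<chi> s = j}" using \<chi> j by blast
    show "{s \<in> S. \<chi> s = j} \<subseteq> X j" using j by (auto simp: X_def \<psi>_def)
    show "X j \<subseteq> PK \<kappa> \<theta>" using S by (auto simp: X_def)
  qed
  have inhabited: "X j \<noteq> {}" if j: "j \<in> J" for j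
  proof -
    have "{} \<in> PK \<kappa> \<theta>" by (rule PK_finite[OF \<kappa>]) simp_all
    then have "\<exists>x\<in>X j. {} \<subseteq> x" by (rule stationary_cofinal[OF \<kappa> stat[OF j]])
    then show ?thesis by auto
  qed
  have "inj_on X J"
  proof (rule inj_onI)
    fix i j assume "i \<in> J" "j \<in> J" "X i = X j"
    then obtain s where "s \<in> X i" "s \<in> X j" using inhabited by blast
    then show "i = j" by (simp add: X_def)
  qed
  then have "bij_betw X J (X ` J)" by (rule inj_on_imp_bij_betw)
  then have "|X ` J| =o |J|" by (rule ordIso_symmetric[OF card_of_ordIsoI])
  moreover have "partition_on S (X ` J)"
    unfolding partition_on_def
  proof (intro conjI)
    show "\<Union> (X ` J) = S" using j0 by (auto simp: X_def \<psi>_def)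
    show "disjoint (X ` J)" by (auto simp: disjoint_def X_def)
    show "{} \<notin> X ` J" using inhabited by auto
  qed
  ultimately show ?thesis using stat by (intro exI[of _ "X ` J"]) blast
qed

theorem theorem2:
  fixes \<kappa> :: "'b rel" and \<theta> :: "'a rel" and S :: "'a set set"
  assumes "regular_uncountable \<kappa>"
    and "Card_order \<theta>"
    and "\<kappa> \<le>o \<theta>"
    and "strong_limit_cardinal \<theta>"
    and "singular_cardinal \<theta>"
    and "stationary \<kappa> \<theta> S"
  shows "\<exists>Q. partition_on S Q \<and> (\<forall>X\<in>Q. stationary \<kappa> \<theta> X) \<and> |Q| =o weak_power \<theta> \<kappa>"
proof -
  have sing: "\<not> regularCard \<theta>" using assms(5) by (simp add: singular_cardinal_def)
  have "\<not> \<kappa> =o \<theta>"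
    using regularCard_ordIso[OF _ regular_uncountableD(4,3)[OF assms(1)]] sing by blast
  then have "\<kappa> <o \<theta>" using assms(3) by (simp add: ordLeq_iff_ordLess_or_ordIso)
  then interpret strong_limit_PK \<kappa> \<theta>
    using assms(1,4) by unfold_locales
  obtain D where D: "D \<subseteq> Field \<theta>" "cofinal D \<theta>" "\<not> |D| =o \<theta>"
    using sing by (auto simp: regularCard_def)
  have "|D| \<le>o \<theta>"
    using ordLeq_ordIso_trans[OF card_of_mono1[OF D(1)] card_of_Field_ordIso[OF assms(2)]] .
  then have D_less: "|D| <o \<theta>" using D(3) by (simp add: ordLeq_iff_ordLess_or_ordIso)
  have "splits \<kappa> \<theta> S (PK \<kappa> \<theta>)"
    using splits_regular[OF D(1,2) D_less assms(6)] splits_singular[OF D(1,2) D_less assms(6)] by blast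
  moreover have "S \<subseteq> PK \<kappa> \<theta>" using assms(6) by (simp add: stationary_def)
  moreover have "PK \<kappa> \<theta> \<noteq> {}" using Cinfinite_PK Cinfinite_card_of[of "PK \<kappa> \<theta>"] by auto
  ultimately obtain Q where Q: "partition_on S Q" "\<forall>X\<in>Q. stationary \<kappa> \<theta> X" "|Q| =o |PK \<kappa> \<theta>|"
    using partition_if_splits[OF assms(1)] by blast
  from Q(3) have "|Q| =o weak_power \<theta> \<kappa>"
    by (rule ordIso_transitive[OF _ ordIso_symmetric[OF weak_power_eq_PK]])
  with Q(1,2) show ?thesis by blast
qed

end
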